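(* There is an absolute constant $C>0$ such that the following holds. Let $N=2^n$, $M=2^{n-r}$ with $0\le r\le n$, and let $H=\sum_{j=1}^K h_j\Lambda_j$ be an $n$-qubit Hamiltonian, where each $h_j>0$ and each $\Lambda_j$ is an $n$-qubit Pauli string (up to a sign $\pm1$), and put $h=\sum_{j=1}^K h_j$. Let $\{P_i\}_{i=1}^M$ be mutually orthogonal projectors of rank $2^r$ each with $\sum_iP_i=\mathbb{I}_N$, and let $\rho$ be a density matrix on $\mathbb{C}^N$ of which independent copies are available. Let $U_{\mathrm{gl}}$ be a global unitary as in the definition of the observational ergotropy $\mathrm{Erg}_{\mathrm{obs}}(\rho)$. For every $\varepsilon>0$ and $\delta\in(0,1)$, and every integer $T\ge1$ with $$T\ge C\,\frac{h^2\log(2/\delta)}{\varepsilon^2},$$ the output $\mu$ of the Pauli-sampling work-extraction protocol (defined in the context) run with $T$ iterations, each consuming one fresh copy of $\rho$, satisfies $|\mu-\mathrm{Erg}_{\mathrm{obs}}(\rho)|\le\varepsilon$ with probability at least $1-\delta$.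
   Context: Definitions. Put $p_i=\mathrm{Tr}[P_i\rho]$ and $\widetilde\rho=\sum_{i=1}^M p_iP_i/2^r$. The observational ergotropy of $\rho$ with respect to $H$ and $\{P_i\}$ is $$\mathrm{Erg}_{\mathrm{obs}}(\rho)=\mathrm{Tr}[H\rho]-\min_{U\in\mathsf{U}(N)}\mathrm{Tr}[HU\widetilde\rho U^\dagger]=\mathrm{Tr}\big[H(\rho-U_{\mathrm{gl}}\widetilde\rho U_{\mathrm{gl}}^\dagger)\big],$$ where $U_{\mathrm{gl}}$ is a unitary mapping an orthonormal basis adapted to the ranges of the $P_i$, with the blocks taken in non-increasing order of $p_i$, to an orthonormal eigenbasis of $H$ listed in non-decreasing order of energy. A Pauli string is a tensor product of $n$ matrices from $\{\mathbb{I}_2,X,Y,Z\}$. Identify $\mathbb{C}^N$ with $\mathbb{C}^M\otimes(\mathbb{C}^2)^{\otimes r}$ so that $P_i=|i\rangle\langle i|\otimes\mathbb{I}_{2^r}$. The $r$-qubit Pauli group is the group of the $4^{r+1}$ unitaries $i^k\sigma_1\otimes\cdots\otimes\sigma_r$ with $k\in\{0,1,2,3\}$ and $\sigma_j\in\{\mathbb{I}_2,X,Y,Z\}$. "Measuring" a Hermitian observable $O$ on a state $\sigma$ returns an eigenvalue $\lambda$ of $O$ with probability $\mathrm{Tr}[\sigma\Pi_\lambda]$, $\Pi_\lambda$ being the corresponding eigenprojector. Pauli-sampling work-extraction protocol. In each of $T$ independent iterations $j=1,\dots,T$, on a fresh copy of $\rho$: (1) with probability $1/2$, sample $\Lambda$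 equal to $\Lambda_i$ with probability $h_i/h$, measure $\Lambda$ on $\rho$ and let $\mu_j$ be the outcome; (2) with probability $1/2$: (a) perform the projective measurement $\{P_i\}$ on $\rho$ and ignore the outcome, obtaining the post-measurement state $\bar\rho$; (b) sample $U_r$ uniformly at random from the $r$-qubit Pauli group and apply $U_{\mathrm{gl}}(\mathbb{I}_M\otimes U_r)$ to $\bar\rho$, obtaining $\rho'=U_{\mathrm{gl}}(\mathbb{I}_M\otimes U_r)\bar\rho(\mathbb{I}_M\otimes U_r)^\dagger U_{\mathrm{gl}}^\dagger$; (c) sample $\Lambda$ equal to $\Lambda_i$ with probability $h_i/h$, measure $-\Lambda$ on $\rho'$ and let $\mu_j$ be the outcome. The output is $\mu=\frac{2h}{T}\sum_{j=1}^T\mu_j$. *)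

theory Defs
  imports
    "HOL-Probability.Product_PMF"
    "Jordan_Normal_Form.Schur_Decomposition"
    "Jordan_Normal_Form.DL_Rank"
begin

text \<open>The Euclidean-space notation of HOL-Analysis clashes with that of \<^theory>\<open>Jordan_Normal_Form.Matrix\<close>.\<close>

unbundle no vec_syntax
unbundle no inner_syntax

section \<open>Matrices\<close>

definition mat_trace :: "complex mat \<Rightarrow> complex" where
  "mat_trace A = (\<Sum>i<dim_row A. A $$ (i, i))"

definition mat_sum :: "nat \<Rightarrow> ('i \<Rightarrow> complex mat) \<Rightarrow> 'i set \<Rightarrow> complex mat" where
  "mat_sum N A S = mat N N (\<lambda>(a, b). \<Sum>i\<in>S. A i $$ (a, b))"

definition kron :: "complex mat \<Rightarrow> complex mat \<Rightarrow> complex mat" where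
  "kron A B = mat (dim_row A * dim_row B) (dim_col A * dim_col B)
     (\<lambda>(a, b). A $$ (a div dim_row B, b div dim_col B) * B $$ (a mod dim_row B, b mod dim_col B))"

definition unitary_mat :: "nat \<Rightarrow> complex mat \<Rightarrow> bool" where
  "unitary_mat N U \<longleftrightarrow>
     U \<in> carrier_mat N N \<and> U * mat_adjoint U = 1\<^sub>m N \<and> mat_adjoint U * U = 1\<^sub>m N"

definition orth_projector :: "nat \<Rightarrow> complex mat \<Rightarrow> bool" where
  "orth_projector N P \<longleftrightarrow> P \<in> carrier_mat N N \<and> mat_adjoint P = P \<and> P * P = P"

definition density_matrix :: "nat \<Rightarrow> complex mat \<Rightarrow> bool" where
  "density_matrix N \<rho> \<longleftrightarrow>
     \<rho> \<in> carrier_mat N N \<and> mat_adjoint \<rho> = \<rho> \<and>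
     (\<forall>v\<in>carrier_vec N. Re ((\<rho> *\<^sub>v v) \<bullet>c v) \<ge> 0) \<and> mat_trace \<rho> = 1"

definition orthonormal_basis :: "nat \<Rightarrow> (nat \<Rightarrow> complex vec) \<Rightarrow> bool" where
  "orthonormal_basis N f \<longleftrightarrow>
     (\<forall>k<N. f k \<in> carrier_vec N) \<and>
     (\<forall>k<N. \<forall>l<N. f k \<bullet>c f l = (if k = l then 1 else 0))"

definition matrix_unit :: "nat \<Rightarrow> nat \<Rightarrow> complex mat" where
  "matrix_unit M i = mat M M (\<lambda>(a, b). if a = i \<and> b = i then 1 else 0)"

section \<open>Pauli strings and the Pauli group\<close>

datatype pauli = PI | PX | PY | PZ

fun pauli_mat :: "pauli \<Rightarrow> complex mat" where
  "pauli_mat PI = 1\<^sub>m 2"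
| "pauli_mat PX = mat_of_rows_list 2 [[0, 1], [1, 0]]"
| "pauli_mat PY = mat_of_rows_list 2 [[0, - \<i>], [\<i>, 0]]"
| "pauli_mat PZ = mat_of_rows_list 2 [[1, 0], [0, - 1]]"

definition pauli_string :: "pauli list \<Rightarrow> complex mat" where
  "pauli_string ps = foldr (\<lambda>p A. kron (pauli_mat p) A) ps (1\<^sub>m 1)"

definition signed_pauli_string :: "nat \<Rightarrow> complex mat \<Rightarrow> bool" where
  "signed_pauli_string n A \<longleftrightarrow>
     (\<exists>ps s. length ps = n \<and> (s = 1 \<or> s = - 1) \<and> A = s \<cdot>\<^sub>m pauli_string ps)"

definition pauli_group :: "nat \<Rightarrow> complex mat set" where
  "pauli_group r = {\<i> ^ k \<cdot>\<^sub>m pauli_string ps | k ps. k \<in> {0, 1, 2, 3} \<and> length ps = r}"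

section \<open>Coarse-graining and observational ergotropy\<close>

definition coarse_graining :: "nat \<Rightarrow> nat \<Rightarrow> nat \<Rightarrow> (nat \<Rightarrow> complex mat) \<Rightarrow> bool" where
  "coarse_graining N M d P \<longleftrightarrow>
     (\<forall>i<M. orth_projector N (P i) \<and> vec_space.rank N (P i) = d) \<and>
     (\<forall>i<M. \<forall>j<M. i \<noteq> j \<longrightarrow> P i * P j = 0\<^sub>m N N) \<and>
     mat_sum N P {..<M} = 1\<^sub>m N"

definition outcome_prob :: "complex mat \<Rightarrow> complex mat \<Rightarrow> real" where
  "outcome_prob P \<rho> = Re (mat_trace (P * \<rho>))"

definition coarse_state :: "nat \<Rightarrow> nat \<Rightarrow> nat \<Rightarrow> (nat \<Rightarrow> complex mat) \<Rightarrow> complex mat \<Rightarrow> complex mat" where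
  "coarse_state N M d P \<rho> =
     mat_sum N (\<lambda>i. complex_of_real (outcome_prob (P i) \<rho> / real d) \<cdot>\<^sub>m P i) {..<M}"

definition obs_ergotropy ::
  "nat \<Rightarrow> nat \<Rightarrow> nat \<Rightarrow> complex mat \<Rightarrow> (nat \<Rightarrow> complex mat) \<Rightarrow> complex mat \<Rightarrow> real" where
  "obs_ergotropy N M d H P \<rho> =
     Re (mat_trace (H * \<rho>)) -
     (LEAST x. \<exists>U. unitary_mat N U \<and>
        x = Re (mat_trace (H * U * coarse_state N M d P \<rho> * mat_adjoint U)))"

text \<open>The permutation \<open>\<pi>\<close> lists the blocks in non-increasing order of their probabilities;
  \<open>f (i * d + k)\<close>, for \<open>k < d\<close>, is an orthonormal basis of the range of \<open>P (\<pi> i)\<close>.\<close>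

definition global_unitary ::
  "nat \<Rightarrow> nat \<Rightarrow> nat \<Rightarrow> complex mat \<Rightarrow> (nat \<Rightarrow> complex mat) \<Rightarrow> complex mat \<Rightarrow> complex mat \<Rightarrow> bool" where
  "global_unitary N M d H P \<rho> U \<longleftrightarrow>
     unitary_mat N U \<and>
     (\<exists>\<pi> f e (E :: nat \<Rightarrow> real).
        bij_betw \<pi> {..<M} {..<M} \<and>
        (\<forall>i<M. \<forall>j<M. i \<le> j \<longrightarrow> outcome_prob (P (\<pi> j)) \<rho> \<le> outcome_prob (P (\<pi> i)) \<rho>) \<and>
        orthonormal_basis N f \<and>
        (\<forall>i<M. \<forall>k<d. P (\<pi> i) *\<^sub>v f (i * d + k) = f (i * d + k)) \<and>
        orthonormal_basis N e \<and>
        (\<forall>k<N. H *\<^sub>v e k = complex_of_real (E k) \<cdot>\<^sub>v e k) \<and>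
        (\<forall>k<N. \<forall>l<N. k \<le> l \<longrightarrow> E k \<le> E l) \<and>
        (\<forall>k<N. U *\<^sub>v f k = e k))"

text \<open>An identification of \<open>\<complex>\<^sup>N\<close> with \<open>\<complex>\<^sup>M \<otimes> \<complex>\<^sup>d\<close>, given by a unitary \<open>V\<close> from the latter space to
  the former, under which \<open>P i\<close> corresponds to \<open>|i><i| \<otimes> I\<close>.\<close>

definition block_identification ::
  "nat \<Rightarrow> nat \<Rightarrow> nat \<Rightarrow> (nat \<Rightarrow> complex mat) \<Rightarrow> complex mat \<Rightarrow> bool" where
  "block_identification N M d P V \<longleftrightarrow>
     unitary_mat N V \<and>
     (\<forall>i<M. P i = V * kron (matrix_unit M i) (1\<^sub>m d) * mat_adjoint V)"

section \<open>Measurements and the protocol\<close>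

text \<open>The orthogonal projector onto the eigenspace \<open>{v. A v = \<lambda> v}\<close>; it is \<open>0\<close> if \<open>\<lambda>\<close> is not
  an eigenvalue.\<close>

definition eigenprojector :: "complex mat \<Rightarrow> real \<Rightarrow> complex mat" where
  "eigenprojector A l = (THE Q. orth_projector (dim_row A) Q \<and>
     (\<forall>v\<in>carrier_vec (dim_row A). Q *\<^sub>v v = v \<longleftrightarrow> A *\<^sub>v v = complex_of_real l \<cdot>\<^sub>v v))"

definition measure_observable :: "complex mat \<Rightarrow> complex mat \<Rightarrow> real pmf" where
  "measure_observable A \<sigma> = embed_pmf (\<lambda>l. Re (mat_trace (\<sigma> * eigenprojector A l)))"

definition sample_term :: "nat \<Rightarrow> (nat \<Rightarrow> real) \<Rightarrow> nat pmf" where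
  "sample_term K h = embed_pmf (\<lambda>j. if j < K then h j / (\<Sum>i<K. h i) else 0)"

text \<open>The state after the measurement \<open>{P i}\<close> when the outcome is discarded.\<close>

definition post_measurement_state :: "nat \<Rightarrow> nat \<Rightarrow> (nat \<Rightarrow> complex mat) \<Rightarrow> complex mat \<Rightarrow> complex mat" where
  "post_measurement_state N M P \<rho> = mat_sum N (\<lambda>i. P i * \<rho> * P i) {..<M}"

definition evolve :: "complex mat \<Rightarrow> complex mat \<Rightarrow> complex mat" where
  "evolve U \<sigma> = U * \<sigma> * mat_adjoint U"

definition protocol_iteration ::
  "nat \<Rightarrow> nat \<Rightarrow> nat \<Rightarrow> (nat \<Rightarrow> real) \<Rightarrow> (nat \<Rightarrow> complex mat) \<Rightarrow> (nat \<Rightarrow> complex mat) \<Rightarrow>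
   complex mat \<Rightarrow> complex mat \<Rightarrow> complex mat \<Rightarrow> real pmf" where
  "protocol_iteration n r K h \<Lambda> P V Ugl \<rho> =
     bind_pmf (bernoulli_pmf (1/2)) (\<lambda>b.
       if b then
         bind_pmf (sample_term K h) (\<lambda>j. measure_observable (\<Lambda> j) \<rho>)
       else
         bind_pmf (pmf_of_set (pauli_group r)) (\<lambda>Ur.
         bind_pmf (sample_term K h) (\<lambda>j.
           measure_observable (- \<Lambda> j)
             (evolve (Ugl * (V * kron (1\<^sub>m (2 ^ (n - r))) Ur * mat_adjoint V))
               (post_measurement_state (2 ^ n) (2 ^ (n - r)) P \<rho>)))))"

definition protocol_output ::
  "nat \<Rightarrow> nat \<Rightarrow> nat \<Rightarrow> (nat \<Rightarrow> real) \<Rightarrow> (nat \<Rightarrow> complex mat) \<Rightarrow> (nat \<Rightarrow> complex mat) \<Rightarrow>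
   complex mat \<Rightarrow> complex mat \<Rightarrow> complex mat \<Rightarrow> nat \<Rightarrow> real pmf" where
  "protocol_output n r K h \<Lambda> P V Ugl \<rho> T =
     map_pmf (\<lambda>\<mu>. 2 * (\<Sum>i<K. h i) / real T * (\<Sum>j\<in>{1..T}. \<mu> j))
       (Pi_pmf {1..T} 0 (\<lambda>_. protocol_iteration n r K h \<Lambda> P V Ugl \<rho>))"

end

theory Submission
  imports Defs "HOL-Probability.Hoeffding"
begin

text \<open>A signed Pauli string is a Hermitian involution, so each measurement returns \<open>\<plusminus>1\<close>, with mean
  \<open>Tr[\<sigma> \<Lambda>]\<close>. Averaging \<open>U\<^sub>r\<close> over the Pauli group replaces every block of the post-measurement state by
  its trace times the maximally mixed state, which turns that state into the coarse-grained one. By the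
  rearrangement inequality for doubly stochastic matrices, the global unitary attains the minimum in the
  observational ergotropy. Hence \<open>2 h \<mu>\<^sub>j\<close> has mean \<open>Erg\<^sub>o\<^sub>b\<^sub>s\<close>, and Hoeffding's inequality gives
  \<open>C = 8\<close>.\<close>

subsection \<open>Matrices\<close>

text \<open>Several notions are descriptions that carry information only once an object meeting them
  is exhibited: \<open>eigenprojector\<close> is a definite description,
  \<open>measure_observable\<close> and \<open>sample_term\<close> go through
  \<open>embed_pmf\<close>, and the minimum is a \<open>LEAST\<close> over reals. Hence the explicit
  spectral projectors (1 + s A)/2, the explicit two-point distribution, and the need for an attained
  minimum. The twirl acts inside blocks only. It would turn an off-diagonal block X into (Tr X /
  2^r) times the identity, not into 0; the preceding projective measurement is what removes these
  blocks. In the output, the factor 2 undoes the fair coin and the factor h undoes the normalisation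
  of the sampling weights. Each summand 2 h \<mu>_j lies in an interval of length 4 h, so the
  Hoeffding exponent is 2 T \<epsilon>^2 / (4 h)^2 = T \<epsilon>^2 / (8 h^2); the bound 2 exp(- T
  \<epsilon>^2 / (8 h^2)) is at most \<delta> exactly when T is at least 8 h^2 ln(2/\<delta>) /
  \<epsilon>^2.\<close>

lemma mat_adjoint_dim [simp]:
  "dim_row (mat_adjoint A) = dim_col A" "dim_col (mat_adjoint A) = dim_row A"
  by (auto simp: mat_adjoint_def)

lemma mat_adjoint_carrier [simp]:
  "mat_adjoint A \<in> carrier_mat n m \<longleftrightarrow> A \<in> carrier_mat m n"
  using carrier_matI[of "mat_adjoint A" n m] carrier_matI[of A m n] by fastforce

lemma index_mat_adjoint [simp]:
  fixes A :: "complex mat"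
  assumes "i < dim_col A" "j < dim_row A"
  shows "mat_adjoint A $$ (i, j) = cnj (A $$ (j, i))"
  using assms by (simp add: mat_adjoint_def mat_of_rows_def)

text \<open>Entries as explicit sums can be swapped and split into blocks. Proofs that rely on this
  form remove \<open>index_mult_mat(1)\<close> from the simplifier, which would turn the entry back
  into a scalar product of a row and a column.\<close>

lemma index_mult_mat_sum:
  assumes "A \<in> carrier_mat n m" "B \<in> carrier_mat m k" "i < n" "j < k"
  shows "(A * B) $$ (i, j) = (\<Sum>l<m. A $$ (i, l) * B $$ (l, j))"
  using assms by (simp add: scalar_prod_def atLeast0LessThan)

lemma mat_adjoint_mult:
  fixes A B :: "complex mat"
  assumes "A \<in> carrier_mat n m" "B \<in> carrier_mat m k"
  shows "mat_adjoint (A * B) = mat_adjoint B * mat_adjoint A"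
proof (rule eq_matI)
  fix i j assume "i < dim_row (mat_adjoint B * mat_adjoint A)" "j < dim_col (mat_adjoint B * mat_adjoint A)"
  then have ij: "i < k" "j < n" using assms by auto
  have "mat_adjoint (A * B) $$ (i, j) = cnj ((A * B) $$ (j, i))"
    using ij assms by (intro index_mat_adjoint) auto
  also have "\<dots> = (\<Sum>l<m. cnj (A $$ (j, l)) * cnj (B $$ (l, i)))"
    using index_mult_mat_sum[OF assms ij(2,1)] by (simp add: cnj_sum)
  also have "\<dots> = (\<Sum>l<m. mat_adjoint B $$ (i, l) * mat_adjoint A $$ (l, j))"
    using ij assms by (intro sum.cong) (auto simp: mult.commute)
  also have "\<dots> = (mat_adjoint B * mat_adjoint A) $$ (i, j)"
    using ij assms by (intro index_mult_mat_sum[symmetric]) auto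
  finally show "mat_adjoint (A * B) $$ (i, j) = (mat_adjoint B * mat_adjoint A) $$ (i, j)" .
qed (use assms in auto)

lemma mat_adjoint_mat_adjoint [simp]: "mat_adjoint (mat_adjoint A) = (A :: complex mat)"
  by (rule eq_matI) auto

lemma mat_adjoint_one [simp]: "mat_adjoint (1\<^sub>m n) = (1\<^sub>m n :: complex mat)"
  by (rule eq_matI) auto

lemma mat_adjoint_smult: "mat_adjoint (c \<cdot>\<^sub>m A) = cnj c \<cdot>\<^sub>m mat_adjoint (A :: complex mat)"
  by (rule eq_matI) auto

lemma cscalar_prod_sum:
  assumes "w \<in> carrier_vec n"
  shows "v \<bullet>c w = (\<Sum>i<n. v $ i * cnj (w $ i :: complex))"
  using assms by (simp add: scalar_prod_def atLeast0LessThan)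

lemma cscalar_prod_mult_mat_vec:
  fixes A :: "complex mat"
  assumes "A \<in> carrier_mat n m" "v \<in> carrier_vec m" "w \<in> carrier_vec n"
  shows "(A *\<^sub>v v) \<bullet>c w = v \<bullet>c (mat_adjoint A *\<^sub>v w)"
proof -
  have "(A *\<^sub>v v) \<bullet>c w = (\<Sum>i<n. \<Sum>j<m. A $$ (i, j) * v $ j * cnj (w $ i))"
    using assms by (simp add: cscalar_prod_sum scalar_prod_def atLeast0LessThan sum_distrib_right)
  also have "\<dots> = (\<Sum>j<m. \<Sum>i<n. A $$ (i, j) * v $ j * cnj (w $ i))"
    by (rule sum.swap)
  also have "\<dots> = v \<bullet>c (mat_adjoint A *\<^sub>v w)"
    using assms
    by (subst cscalar_prod_sum[of _ m])
       (auto simp: scalar_prod_def atLeast0LessThan sum_distrib_left cnj_sum intro!: sum.cong mult_mat_vec_carrier)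
  finally show ?thesis .
qed

lemma mat_trace_mult:
  assumes "A \<in> carrier_mat n m" "B \<in> carrier_mat m n"
  shows "mat_trace (A * B) = (\<Sum>i<n. \<Sum>j<m. A $$ (i, j) * B $$ (j, i))"
  using assms index_mult_mat_sum[OF assms] by (simp add: mat_trace_def del: index_mult_mat(1))

lemma mat_trace_comm:
  assumes "A \<in> carrier_mat n m" "B \<in> carrier_mat m n"
  shows "mat_trace (A * B) = mat_trace (B * A)"
proof -
  have "mat_trace (A * B) = (\<Sum>j<m. \<Sum>i<n. A $$ (i, j) * B $$ (j, i))"
    using assms by (simp add: mat_trace_mult sum.swap[of _ "{..<n}"])
  also have "\<dots> = mat_trace (B * A)"
    using mat_trace_mult[OF assms(2,1)] by (simp add: mult.commute)
  finally show ?thesis .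
qed

lemma mat_trace_conjugate:
  assumes "A \<in> carrier_mat n n" "unitary_mat n U"
  shows "mat_trace (U * A * mat_adjoint U) = mat_trace A"
proof -
  have U: "U \<in> carrier_mat n n" "mat_adjoint U * U = 1\<^sub>m n" using assms by (auto simp: unitary_mat_def)
  have "mat_trace (U * A * mat_adjoint U) = mat_trace (mat_adjoint U * (U * A))"
    using assms U by (intro mat_trace_comm[of _ n n]) auto
  also have "mat_adjoint U * (U * A) = mat_adjoint U * U * A"
    using assms U by (intro assoc_mult_mat[symmetric, of _ n n _ n _ n]) auto
  finally show ?thesis using assms U by simp
qed

lemma mat_trace_smult: "mat_trace (c \<cdot>\<^sub>m A) = c * mat_trace A" if "A \<in> carrier_mat n n"
  using that by (simp add: mat_trace_def sum_distrib_left)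

lemma mat_trace_add:
  "mat_trace (A + B) = mat_trace A + mat_trace B" if "A \<in> carrier_mat n n" "B \<in> carrier_mat n n"
  using that by (simp add: mat_trace_def sum.distrib)

lemma mat_sum_carrier [simp]: "mat_sum N F S \<in> carrier_mat N N"
  by (simp add: mat_sum_def)

lemma mat_sum_dim [simp]: "dim_row (mat_sum N F S) = N" "dim_col (mat_sum N F S) = N"
  by (auto simp: mat_sum_def)

lemma index_mat_sum [simp]: "i < N \<Longrightarrow> j < N \<Longrightarrow> mat_sum N F S $$ (i, j) = (\<Sum>s\<in>S. F s $$ (i, j))"
  by (simp add: mat_sum_def)

lemma mat_sum_cong: "(\<And>s. s \<in> S \<Longrightarrow> F s = G s) \<Longrightarrow> mat_sum N F S = mat_sum N G S"
  by (simp add: mat_sum_def)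

lemma mult_mat_sum:
  assumes "A \<in> carrier_mat N N" "\<And>s. s \<in> S \<Longrightarrow> F s \<in> carrier_mat N N"
  shows "A * mat_sum N F S = mat_sum N (\<lambda>s. A * F s) S"
proof (rule eq_matI)
  fix i j assume "i < dim_row (mat_sum N (\<lambda>s. A * F s) S)" "j < dim_col (mat_sum N (\<lambda>s. A * F s) S)"
  then have ij: "i < N" "j < N" by auto
  have "(A * mat_sum N F S) $$ (i, j) = (\<Sum>l<N. \<Sum>s\<in>S. A $$ (i, l) * F s $$ (l, j))"
    using index_mult_mat_sum[OF assms(1) mat_sum_carrier ij] ij by (simp add: sum_distrib_left)
  also have "\<dots> = (\<Sum>s\<in>S. \<Sum>l<N. A $$ (i, l) * F s $$ (l, j))" by (rule sum.swap)
  also have "\<dots> = (\<Sum>s\<in>S. (A * F s) $$ (i, j))"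
    using ij assms by (intro sum.cong refl index_mult_mat_sum[symmetric, where n = N and k = N]) auto
  finally show "(A * mat_sum N F S) $$ (i, j) = mat_sum N (\<lambda>s. A * F s) S $$ (i, j)" using ij by simp
qed (use assms in auto)

lemma mat_sum_mult:
  assumes "A \<in> carrier_mat N N" "\<And>s. s \<in> S \<Longrightarrow> F s \<in> carrier_mat N N"
  shows "mat_sum N F S * A = mat_sum N (\<lambda>s. F s * A) S"
proof (rule eq_matI)
  fix i j assume "i < dim_row (mat_sum N (\<lambda>s. F s * A) S)" "j < dim_col (mat_sum N (\<lambda>s. F s * A) S)"
  then have ij: "i < N" "j < N" by auto
  have "(mat_sum N F S * A) $$ (i, j) = (\<Sum>l<N. \<Sum>s\<in>S. F s $$ (i, l) * A $$ (l, j))"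
    using index_mult_mat_sum[OF mat_sum_carrier assms(1) ij] ij by (simp add: sum_distrib_right)
  also have "\<dots> = (\<Sum>s\<in>S. \<Sum>l<N. F s $$ (i, l) * A $$ (l, j))" by (rule sum.swap)
  also have "\<dots> = (\<Sum>s\<in>S. (F s * A) $$ (i, j))"
    using ij assms by (intro sum.cong refl index_mult_mat_sum[symmetric, where n = N and k = N]) auto
  finally show "(mat_sum N F S * A) $$ (i, j) = mat_sum N (\<lambda>s. F s * A) S $$ (i, j)" using ij by simp
qed (use assms in auto)

lemma mat_trace_mat_sum:
  assumes "\<And>s. s \<in> S \<Longrightarrow> F s \<in> carrier_mat N N"
  shows "mat_trace (mat_sum N F S) = (\<Sum>s\<in>S. mat_trace (F s))"
proof -
  have "mat_trace (mat_sum N F S) = (\<Sum>s\<in>S. \<Sum>i<N. F s $$ (i, i))"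
    by (simp add: mat_trace_def sum.swap[of _ "{..<N}"])
  also have "\<dots> = (\<Sum>s\<in>S. mat_trace (F s))"
    using assms by (intro sum.cong refl) (simp add: mat_trace_def carrier_matD(1)[OF assms])
  finally show ?thesis .
qed

subsection \<open>Kronecker products\<close>

lemma kron_carrier [simp]:
  "A \<in> carrier_mat a b \<Longrightarrow> B \<in> carrier_mat c d \<Longrightarrow> kron A B \<in> carrier_mat (a * c) (b * d)"
  by (auto simp: kron_def)

lemma kron_dim [simp]:
  "dim_row (kron A B) = dim_row A * dim_row B" "dim_col (kron A B) = dim_col A * dim_col B"
  by (auto simp: kron_def)

lemma index_kron:
  "i < dim_row A * dim_row B \<Longrightarrow> j < dim_col A * dim_col B \<Longrightarrow>
   kron A B $$ (i, j) = A $$ (i div dim_row B, j div dim_col B) * B $$ (i mod dim_row B, j mod dim_col B)"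
  by (auto simp: kron_def)

text \<open>Matches the index convention of \<open>kron\<close>: the quotient by \<open>q\<close>
  addresses the first tensor factor (the block), the remainder the second (the position within the
  block).\<close>

lemma sum_lessThan_times:
  fixes g :: "nat \<Rightarrow> 'a :: comm_monoid_add"
  shows "(\<Sum>k<p*q. g k) = (\<Sum>i<p. \<Sum>j<q. g (i * q + j))"
proof -
  have "sum g {i * q..<i * q + q} = (\<Sum>j<q. g (i * q + j))" for i
    using sum.shift_bounds_nat_ivl[of g 0 "i * q" q] by (simp add: atLeast0LessThan add.commute)
  then show ?thesis using sum.nat_group[of g q p] by simp
qed

lemma mult_add_less: "i < p \<Longrightarrow> j < q \<Longrightarrow> i * q + j < p * (q :: nat)"
  using mult_le_mono1[of "Suc i" p q] by simp

text \<open>Mixed-product rule: the inner summation index splits into quotient and remainder, and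
  the double sum factors.\<close>

lemma kron_mult:
  assumes "A \<in> carrier_mat a b" "B \<in> carrier_mat c d" "A' \<in> carrier_mat b e" "B' \<in> carrier_mat d f"
  shows "kron A B * kron A' B' = kron (A * A') (B * B')"
proof (rule eq_matI)
  fix i j assume "i < dim_row (kron (A * A') (B * B'))" "j < dim_col (kron (A * A') (B * B'))"
  then have ij: "i < a * c" "j < e * f" using assms by auto
  then have ij': "i div c < a" "i mod c < c" "j div f < e" "j mod f < f"
    by (auto simp: less_mult_imp_div_less intro!: mod_less_divisor gr0I)
  have "(kron A B * kron A' B') $$ (i, j) = (\<Sum>l<b*d. kron A B $$ (i, l) * kron A' B' $$ (l, j))"
    using assms ij by (intro index_mult_mat_sum) auto
  also have "\<dots> = (\<Sum>k<b. \<Sum>l<d. (A $$ (i div c, k) * B $$ (i mod c, l)) * (A' $$ (k, j div f) * B' $$ (l, j mod f)))"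
    unfolding sum_lessThan_times
  proof (intro sum.cong refl)
    fix k l assume "k \<in> {..<b}" "l \<in> {..<d}"
    then have "k * d + l < b * d" "(k * d + l) div d = k" "(k * d + l) mod d = l"
      by (auto intro: mult_add_less)
    then show "kron A B $$ (i, k * d + l) * kron A' B' $$ (k * d + l, j) =
      (A $$ (i div c, k) * B $$ (i mod c, l)) * (A' $$ (k, j div f) * B' $$ (l, j mod f))"
      using assms ij by (simp add: index_kron del: div_mult_self3 div_mult_self4)
  qed
  also have "\<dots> = (\<Sum>k<b. A $$ (i div c, k) * A' $$ (k, j div f)) * (\<Sum>l<d. B $$ (i mod c, l) * B' $$ (l, j mod f))"
    by (simp add: sum_product ac_simps)
  also have "\<dots> = (A * A') $$ (i div c, j div f) * (B * B') $$ (i mod c, j mod f)"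
    using assms ij' by (simp add: index_mult_mat_sum[of A a b] index_mult_mat_sum[of B c d] del: index_mult_mat(1))
  also have "\<dots> = kron (A * A') (B * B') $$ (i, j)"
    using assms ij by (simp add: index_kron del: index_mult_mat(1))
  finally show "(kron A B * kron A' B') $$ (i, j) = kron (A * A') (B * B') $$ (i, j)" .
qed (use assms in auto)

lemma div_mod_less: "i < p * q \<Longrightarrow> i div q < p \<and> i mod q < (q :: nat)"
  by (auto simp: less_mult_imp_div_less intro!: mod_less_divisor gr0I)

lemma mat_adjoint_kron: "mat_adjoint (kron A B) = kron (mat_adjoint A) (mat_adjoint B)"
  by (rule eq_matI) (auto simp: index_kron div_mod_less)

lemma kron_one: "kron (1\<^sub>m a) (1\<^sub>m b) = 1\<^sub>m (a * b)"
proof (rule eq_matI)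
  fix i j assume "i < dim_row (1\<^sub>m (a * b) :: complex mat)" "j < dim_col (1\<^sub>m (a * b) :: complex mat)"
  moreover have "i = j" if "i div b = j div b" "i mod b = j mod b"
    using that by (metis div_mult_mod_eq)
  ultimately show "kron (1\<^sub>m a) (1\<^sub>m b) $$ (i, j) = 1\<^sub>m (a * b) $$ (i, j)"
    by (auto simp: index_kron div_mod_less)
qed auto

lemma unitary_mat_kron_one:
  assumes "unitary_mat d U"
  shows "unitary_mat (m * d) (kron (1\<^sub>m m) U)"
  using assms
  by (auto simp: unitary_mat_def mat_adjoint_kron kron_mult[of _ m m _ d d _ m _ d] kron_one)

lemma unitary_mat_mult:
  assumes "unitary_mat n U" "unitary_mat n V"
  shows "unitary_mat n (U * V)"
proof -
  have c: "U \<in> carrier_mat n n" "V \<in> carrier_mat n n"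
    and e: "U * mat_adjoint U = 1\<^sub>m n" "mat_adjoint U * U = 1\<^sub>m n"
       "V * mat_adjoint V = 1\<^sub>m n" "mat_adjoint V * V = 1\<^sub>m n"
    using assms by (auto simp: unitary_mat_def)
  have "U * V * (mat_adjoint V * mat_adjoint U) = U * (V * mat_adjoint V) * mat_adjoint U"
    using c by (simp add: assoc_mult_mat[of _ n n _ n _ n])
  moreover have "mat_adjoint V * mat_adjoint U * (U * V) = mat_adjoint V * (mat_adjoint U * U) * V"
    using c by (simp add: assoc_mult_mat[of _ n n _ n _ n])
  ultimately show ?thesis
    using c e by (simp add: unitary_mat_def mat_adjoint_mult[of _ n n _ n])
qed

lemma unitary_mat_adjoint: "unitary_mat n U \<Longrightarrow> unitary_mat n (mat_adjoint U)"
  by (auto simp: unitary_mat_def)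

subsection \<open>Density matrices\<close>

text \<open>By \<open>Q * Q = Q\<close> and cyclicity the trace equals Tr[Q \<sigma> Q], which is
  the sum of the quadratic form of \<sigma> over the columns of \<open>Q\<close>.\<close>

lemma density_trace_projector_nonneg:
  assumes "density_matrix N \<sigma>" "orth_projector N Q"
  shows "Re (mat_trace (\<sigma> * Q)) \<ge> 0"
proof -
  have \<sigma>: "\<sigma> \<in> carrier_mat N N" "\<And>v. v \<in> carrier_vec N \<Longrightarrow> Re ((\<sigma> *\<^sub>v v) \<bullet>c v) \<ge> 0"
    and Q: "Q \<in> carrier_mat N N" "mat_adjoint Q = Q" "Q * Q = Q"
    using assms by (auto simp: density_matrix_def orth_projector_def)
  have cnj_Q: "cnj (Q $$ (i, k)) = Q $$ (k, i)" if "i < N" "k < N" for i k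
    using that Q index_mat_adjoint[of k Q i] by simp
  have "mat_trace (\<sigma> * Q) = mat_trace (\<sigma> * Q * Q)"
    using \<sigma> Q by (simp add: assoc_mult_mat[of _ N N _ N _ N])
  also have "\<dots> = mat_trace (Q * (\<sigma> * Q))"
    using \<sigma> Q by (intro mat_trace_comm[of _ N N]) auto
  also have "\<dots> = (\<Sum>k<N. \<Sum>i<N. Q $$ (k, i) * (\<sigma> * Q) $$ (i, k))"
    using \<sigma> Q by (intro mat_trace_mult) auto
  also have "\<dots> = (\<Sum>k<N. (\<sigma> *\<^sub>v col Q k) \<bullet>c col Q k)"
  proof (intro sum.cong refl)
    fix k assume "k \<in> {..<N}"
    then have "(\<sigma> *\<^sub>v col Q k) \<bullet>c col Q k = (\<Sum>i<N. (\<sigma> * Q) $$ (i, k) * cnj (Q $$ (i, k)))"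
      using \<sigma> Q by (subst cscalar_prod_sum[of _ N]) auto
    also have "\<dots> = (\<Sum>i<N. Q $$ (k, i) * (\<sigma> * Q) $$ (i, k))"
      using \<open>k \<in> {..<N}\<close> by (intro sum.cong) (auto simp: cnj_Q)
    finally show "(\<Sum>i<N. Q $$ (k, i) * (\<sigma> * Q) $$ (i, k)) = (\<sigma> *\<^sub>v col Q k) \<bullet>c col Q k" by simp
  qed
  finally show ?thesis using \<sigma> Q by (auto intro!: sum_nonneg)
qed

lemma density_matrix_evolve:
  assumes "density_matrix N \<sigma>" "unitary_mat N U"
  shows "density_matrix N (evolve U \<sigma>)"
  unfolding density_matrix_def evolve_def
proof (intro conjI ballI)
  have \<sigma>: "\<sigma> \<in> carrier_mat N N" "mat_adjoint \<sigma> = \<sigma>" "mat_trace \<sigma> = 1"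
      "\<And>v. v \<in> carrier_vec N \<Longrightarrow> Re ((\<sigma> *\<^sub>v v) \<bullet>c v) \<ge> 0"
    and U: "U \<in> carrier_mat N N"
    using assms by (auto simp: density_matrix_def unitary_mat_def)
  show "U * \<sigma> * mat_adjoint U \<in> carrier_mat N N" using \<sigma> U by auto
  show "mat_adjoint (U * \<sigma> * mat_adjoint U) = U * \<sigma> * mat_adjoint U"
    using \<sigma> U by (simp add: mat_adjoint_mult[of _ N N _ N] assoc_mult_mat[of _ N N _ N _ N])
  show "mat_trace (U * \<sigma> * mat_adjoint U) = 1"
    using \<sigma> assms by (simp add: mat_trace_conjugate)
  fix v :: "complex vec" assume v: "v \<in> carrier_vec N"
  \<comment> \<open>Positivity is inherited because the quadratic form of the evolved state at
    \<open>v\<close> is that of \<sigma> at \<open>w\<close>.\<close>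
  define w where "w = mat_adjoint U *\<^sub>v v"
  have w: "w \<in> carrier_vec N" using U v by (auto simp: w_def intro!: mult_mat_vec_carrier)
  have "U * \<sigma> * mat_adjoint U *\<^sub>v v = U *\<^sub>v (\<sigma> *\<^sub>v w)"
    using \<sigma> U v w by (simp add: w_def assoc_mult_mat_vec[of _ N N _ N])
  also have "\<dots> \<bullet>c v = (\<sigma> *\<^sub>v w) \<bullet>c w"
    unfolding w_def using \<sigma> U v w
    by (intro cscalar_prod_mult_mat_vec) (auto simp: w_def[symmetric] intro!: mult_mat_vec_carrier)
  finally show "0 \<le> Re ((U * \<sigma> * mat_adjoint U *\<^sub>v v) \<bullet>c v)" using \<sigma> w by simp
qed

lemma cscalar_prod_mat_sum:
  assumes "\<And>s. s \<in> S \<Longrightarrow> F s \<in> carrier_mat N N" "v \<in> carrier_vec N"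
  shows "(mat_sum N F S *\<^sub>v v) \<bullet>c v = (\<Sum>s\<in>S. (F s *\<^sub>v v) \<bullet>c v)"
proof -
  have "(mat_sum N F S *\<^sub>v v) \<bullet>c v = (\<Sum>i<N. \<Sum>j<N. \<Sum>s\<in>S. F s $$ (i, j) * v $ j * cnj (v $ i))"
    using assms by (simp add: cscalar_prod_sum[of _ N] scalar_prod_def atLeast0LessThan sum_distrib_right)
  also have "\<dots> = (\<Sum>i<N. \<Sum>s\<in>S. \<Sum>j<N. F s $$ (i, j) * v $ j * cnj (v $ i))"
    by (intro sum.cong refl sum.swap)
  also have "\<dots> = (\<Sum>s\<in>S. \<Sum>i<N. \<Sum>j<N. F s $$ (i, j) * v $ j * cnj (v $ i))"
    by (rule sum.swap)
  also have "\<dots> = (\<Sum>s\<in>S. (F s *\<^sub>v v) \<bullet>c v)"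
  proof (intro sum.cong refl)
    fix s assume "s \<in> S"
    then have "F s \<in> carrier_mat N N" by (rule assms)
    then show "(\<Sum>i<N. \<Sum>j<N. F s $$ (i, j) * v $ j * cnj (v $ i)) = (F s *\<^sub>v v) \<bullet>c v"
      using assms by (simp add: cscalar_prod_sum[of _ N] scalar_prod_def atLeast0LessThan sum_distrib_right)
  qed
  finally show ?thesis .
qed

lemma density_matrix_post_measurement:
  assumes "density_matrix N \<rho>" "coarse_graining N M d P"
  shows "density_matrix N (post_measurement_state N M P \<rho>)"
  unfolding density_matrix_def post_measurement_state_def
proof (intro conjI ballI)
  have \<rho>: "\<rho> \<in> carrier_mat N N" "mat_adjoint \<rho> = \<rho>" "mat_trace \<rho> = 1"
      "\<And>v. v \<in> carrier_vec N \<Longrightarrow> Re ((\<rho> *\<^sub>v v) \<bullet>c v) \<ge> 0"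
    using assms by (auto simp: density_matrix_def)
  have P: "P i \<in> carrier_mat N N" "mat_adjoint (P i) = P i" "P i * P i = P i" if "i < M" for i
    using that assms by (auto simp: coarse_graining_def orth_projector_def)
  have sum_P: "mat_sum N P {..<M} = 1\<^sub>m N" using assms by (auto simp: coarse_graining_def)
  have PrP: "P i * \<rho> * P i \<in> carrier_mat N N" if "i < M" for i using P[OF that] \<rho> by auto
  show "mat_sum N (\<lambda>i. P i * \<rho> * P i) {..<M} \<in> carrier_mat N N" by simp
  have adj: "mat_adjoint (P i * \<rho> * P i) = P i * \<rho> * P i" if "i < M" for i
    using P[OF that] \<rho> by (simp add: mat_adjoint_mult[of _ N N _ N] assoc_mult_mat[of _ N N _ N _ N])
  show "mat_adjoint (mat_sum N (\<lambda>i. P i * \<rho> * P i) {..<M}) = mat_sum N (\<lambda>i. P i * \<rho> * P i) {..<M}"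
  proof (rule eq_matI)
    fix a b assume ab: "a < dim_row (mat_sum N (\<lambda>i. P i * \<rho> * P i) {..<M})"
      "b < dim_col (mat_sum N (\<lambda>i. P i * \<rho> * P i) {..<M})"
    have "cnj ((P i * \<rho> * P i) $$ (b, a)) = (P i * \<rho> * P i) $$ (a, b)" if "i < M" for i
    proof -
      have "a < dim_col (P i * \<rho> * P i)" "b < dim_row (P i * \<rho> * P i)"
        using ab carrier_matD[OF PrP[OF that]] by simp_all
      from index_mat_adjoint[OF this] show ?thesis unfolding adj[OF that] by simp
    qed
    then show "mat_adjoint (mat_sum N (\<lambda>i. P i * \<rho> * P i) {..<M}) $$ (a, b)
       = mat_sum N (\<lambda>i. P i * \<rho> * P i) {..<M} $$ (a, b)"
      using ab by (simp add: cnj_sum del: index_mult_mat)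
  qed auto
  \<comment> \<open>Cyclicity and idempotence reduce each summand to Tr[\<rho> P_i]; completeness of
    the projectors then returns Tr \<rho>.\<close>
  have "mat_trace (mat_sum N (\<lambda>i. P i * \<rho> * P i) {..<M}) = (\<Sum>i<M. mat_trace (P i * \<rho> * P i))"
    using PrP by (intro mat_trace_mat_sum) auto
  also have "\<dots> = (\<Sum>i<M. mat_trace (\<rho> * P i))"
  proof (intro sum.cong refl)
    fix i assume "i \<in> {..<M}"
    then have i: "i < M" by simp
    have "mat_trace (P i * \<rho> * P i) = mat_trace (P i * (\<rho> * P i))"
      using P[OF i] \<rho> by (simp add: assoc_mult_mat[of _ N N _ N _ N])
    also have "\<dots> = mat_trace (\<rho> * P i * P i)"
      using P[OF i] \<rho> by (intro mat_trace_comm[of _ N N]) auto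
    finally show "mat_trace (P i * \<rho> * P i) = mat_trace (\<rho> * P i)"
      using P[OF i] \<rho> by (simp add: assoc_mult_mat[of _ N N _ N _ N])
  qed
  also have "\<dots> = mat_trace (\<rho> * mat_sum N P {..<M})"
    using P \<rho> by (subst mult_mat_sum) (auto intro!: mat_trace_mat_sum[symmetric])
  finally show "mat_trace (mat_sum N (\<lambda>i. P i * \<rho> * P i) {..<M}) = 1"
    using \<rho> sum_P by simp
  fix v :: "complex vec" assume v: "v \<in> carrier_vec N"
  have "Re ((P i * \<rho> * P i *\<^sub>v v) \<bullet>c v) \<ge> 0" if "i < M" for i
  proof -
    note P = P[OF that]
    have w: "P i *\<^sub>v v \<in> carrier_vec N" using P v by (auto intro!: mult_mat_vec_carrier)
    have "P i * \<rho> * P i *\<^sub>v v = P i *\<^sub>v (\<rho> *\<^sub>v (P i *\<^sub>v v))"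
      using P \<rho> v w by (simp add: assoc_mult_mat_vec[of _ N N _ N])
    also have "\<dots> \<bullet>c v = (\<rho> *\<^sub>v (P i *\<^sub>v v)) \<bullet>c (mat_adjoint (P i) *\<^sub>v v)"
      using P \<rho> v w by (intro cscalar_prod_mult_mat_vec) (auto intro!: mult_mat_vec_carrier)
    finally show ?thesis using \<rho> w P by simp
  qed
  then show "0 \<le> Re ((mat_sum N (\<lambda>i. P i * \<rho> * P i) {..<M} *\<^sub>v v) \<bullet>c v)"
    using PrP v by (subst cscalar_prod_mat_sum) (auto intro!: sum_nonneg)
qed

subsection \<open>Pauli strings\<close>

lemma pauli_mat_carrier [simp]: "pauli_mat p \<in> carrier_mat 2 2"
  by (cases p) (auto simp: mat_of_rows_list_def)

lemma pauli_mat_dim [simp]: "dim_row (pauli_mat p) = 2" "dim_col (pauli_mat p) = 2"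
  using carrier_matD[OF pauli_mat_carrier[of p]] by auto

lemma index_pauli_mat:
  assumes "i < 2" "j < 2"
  shows "pauli_mat p $$ (i, j) = (case p of
      PI \<Rightarrow> if i = j then 1 else 0
    | PX \<Rightarrow> if i = j then 0 else 1
    | PY \<Rightarrow> if i = j then 0 else if i = 0 then - \<i> else \<i>
    | PZ \<Rightarrow> if i = j then if i = 0 then 1 else - 1 else 0)"
  using assms by (cases p) (auto simp: mat_of_rows_list_def less_2_cases_iff)

declare pauli_mat.simps [simp del]

lemma sum_lessThan_2: "(\<Sum>i<2. f i) = f 0 + f (1::nat)"
  by (simp add: numeral_2_eq_2)

lemma mat_adjoint_pauli_mat [simp]: "mat_adjoint (pauli_mat p) = pauli_mat p"
  by (rule eq_matI; cases p) (auto simp: index_pauli_mat)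

lemma pauli_mat_mult_self: "pauli_mat p * pauli_mat p = 1\<^sub>m 2"
proof (rule eq_matI)
  fix i j assume "i < dim_row (1\<^sub>m 2 :: complex mat)" "j < dim_col (1\<^sub>m 2 :: complex mat)"
  then have "i < 2" "j < 2" by auto
  then show "(pauli_mat p * pauli_mat p) $$ (i, j) = 1\<^sub>m 2 $$ (i, j)"
    by (cases p; subst index_mult_mat_sum[of _ 2 2 _ 2])
       (auto simp: index_pauli_mat sum_lessThan_2 less_2_cases_iff)
qed auto

lemma pauli_string_Nil: "pauli_string [] = 1\<^sub>m 1"
  and pauli_string_Cons: "pauli_string (p # ps) = kron (pauli_mat p) (pauli_string ps)"
  by (auto simp: pauli_string_def)

lemma pauli_string_carrier: "pauli_string ps \<in> carrier_mat (2 ^ length ps) (2 ^ length ps)"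
  by (induction ps) (auto simp: pauli_string_Nil pauli_string_Cons)

lemma pauli_string_dim [simp]:
  "dim_row (pauli_string ps) = 2 ^ length ps" "dim_col (pauli_string ps) = 2 ^ length ps"
  using carrier_matD[OF pauli_string_carrier[of ps]] by auto

lemma mat_adjoint_pauli_string [simp]: "mat_adjoint (pauli_string ps) = pauli_string ps"
  by (induction ps) (auto simp: pauli_string_Nil pauli_string_Cons mat_adjoint_kron)

lemma pauli_string_mult_self: "pauli_string ps * pauli_string ps = 1\<^sub>m (2 ^ length ps)"
  by (induction ps)
     (auto simp: pauli_string_Nil pauli_string_Cons kron_mult[OF pauli_mat_carrier pauli_string_carrier
        pauli_mat_carrier pauli_string_carrier] pauli_mat_mult_self kron_one)

lemma length_Suc_eq_image:
  "{ps :: pauli list. length ps = Suc r} = (\<lambda>(p, ps). p # ps) ` ({PI, PX, PY, PZ} \<times> {ps. length ps = r})"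
proof -
  have "p \<in> {PI, PX, PY, PZ}" for p by (cases p) auto
  then show ?thesis by (auto simp: length_Suc_conv image_iff)
qed

lemma finite_length_eq [simp]: "finite {ps :: pauli list. length ps = r}"
  by (induction r) (auto simp: length_Suc_eq_image simp del: insert_iff)

lemma sum_length_Suc:
  fixes g :: "pauli list \<Rightarrow> 'a :: comm_monoid_add"
  shows "(\<Sum>ps | length ps = Suc r. g ps) = (\<Sum>p\<in>{PI, PX, PY, PZ}. \<Sum>ps | length ps = r. g (p # ps))"
  unfolding length_Suc_eq_image
  by (subst sum.reindex) (auto simp: inj_on_def sum.cartesian_product case_prod_unfold simp del: sum.insert)

text \<open>Scaled by 1/sqrt 2, the four matrices form an orthonormal basis of the 2-by-2 matrices
  for the Hilbert-Schmidt inner product; this is the resolution of the identity in that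
  basis.\<close>

lemma pauli_mat_completeness:
  assumes "a < 2" "b < 2" "c < 2" "e < 2"
  shows "(\<Sum>p\<in>{PI, PX, PY, PZ}. pauli_mat p $$ (a, c) * cnj (pauli_mat p $$ (b, e))) =
    (if a = b \<and> c = e then 2 else 0)"
  using assms by (simp add: index_pauli_mat)

lemma eq_iff_div_mod: "(a :: nat) = b \<longleftrightarrow> a div d = b div d \<and> a mod d = b mod d"
  by (metis div_mult_mod_eq)

text \<open>Entrywise form of the twirl identity: contracting with X over \<open>c\<close> and
  \<open>e\<close> says that the sum of S X S^* over all strings S is 2^r Tr(X) times the identity.
  The leading qubit factors out, since it is the quotient of each index by 2^r.\<close>

lemma pauli_string_completeness:
  assumes "a < 2 ^ r" "b < 2 ^ r" "c < 2 ^ r" "e < 2 ^ r"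
  shows "(\<Sum>ps | length ps = r. pauli_string ps $$ (a, c) * cnj (pauli_string ps $$ (b, e))) =
    (if a = b \<and> c = e then 2 ^ r else 0)"
  using assms
proof (induction r arbitrary: a b c e)
  case 0
  then show ?case by (simp add: pauli_string_Nil)
next
  case (Suc r)
  let ?d = "2 ^ r :: nat"
  have dm: "x div ?d < 2" "x mod ?d < ?d" if "x < 2 ^ Suc r" for x
    using that div_mod_less[of x 2 ?d] by auto
  have "(\<Sum>ps | length ps = Suc r. pauli_string ps $$ (a, c) * cnj (pauli_string ps $$ (b, e))) =
     (\<Sum>p\<in>{PI, PX, PY, PZ}. \<Sum>ps | length ps = r.
       (pauli_mat p $$ (a div ?d, c div ?d) * cnj (pauli_mat p $$ (b div ?d, e div ?d))) *
       (pauli_string ps $$ (a mod ?d, c mod ?d) * cnj (pauli_string ps $$ (b mod ?d, e mod ?d))))"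
    unfolding sum_length_Suc
    using Suc.prems by (intro sum.cong refl) (auto simp: pauli_string_Cons index_kron)
  also have "\<dots> = (\<Sum>p\<in>{PI, PX, PY, PZ}. pauli_mat p $$ (a div ?d, c div ?d) * cnj (pauli_mat p $$ (b div ?d, e div ?d))) *
       (\<Sum>ps | length ps = r. pauli_string ps $$ (a mod ?d, c mod ?d) * cnj (pauli_string ps $$ (b mod ?d, e mod ?d)))"
    by (simp only: sum_product)
  also have "\<dots> = (if a div ?d = b div ?d \<and> c div ?d = e div ?d then 2 else 0) *
      (if a mod ?d = b mod ?d \<and> c mod ?d = e mod ?d then 2 ^ r else 0)"
    using Suc.prems by (intro arg_cong2[where f = "(*)"] pauli_mat_completeness Suc.IH dm)
  also have "\<dots> = (if a = b \<and> c = e then 2 ^ Suc r else 0)"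
    using eq_iff_div_mod[of a b ?d] eq_iff_div_mod[of c e ?d] by auto
  finally show ?case .
qed

lemma pauli_mat_orthogonal:
  "(\<Sum>a<2. \<Sum>b<2. pauli_mat p $$ (a, b) * cnj (pauli_mat q $$ (a, b))) = (if p = q then 2 else 0)"
  by (cases p; cases q) (simp_all add: sum_lessThan_2 index_pauli_mat)

text \<open>Hilbert-Schmidt orthogonality, dual to completeness. Its purpose is to show that
  different labels in the Pauli group denote different matrices.\<close>

lemma pauli_string_orthogonal:
  assumes "length ps = r" "length qs = r"
  shows "(\<Sum>a<2^r. \<Sum>b<2^r. pauli_string ps $$ (a, b) * cnj (pauli_string qs $$ (a, b))) =
    (if ps = qs then 2 ^ r else 0)"
  using assms
proof (induction r arbitrary: ps qs)
  case 0
  then show ?case by (simp add: pauli_string_Nil)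
next
  case (Suc r)
  let ?d = "2 ^ r :: nat"
  obtain p ps' q qs' where ps: "ps = p # ps'" "length ps' = r" and qs: "qs = q # qs'" "length qs' = r"
    using Suc.prems by (metis length_Suc_conv)
  have "(\<Sum>a<2^Suc r. \<Sum>b<2^Suc r. pauli_string ps $$ (a, b) * cnj (pauli_string qs $$ (a, b))) =
    (\<Sum>a<2. \<Sum>a'<?d. \<Sum>b<2. \<Sum>b'<?d.
      (pauli_mat p $$ (a, b) * cnj (pauli_mat q $$ (a, b))) *
      (pauli_string ps' $$ (a', b') * cnj (pauli_string qs' $$ (a', b'))))"
    unfolding power_Suc sum_lessThan_times
  proof (intro sum.cong refl)
    fix a a' b b' :: nat assume "a \<in> {..<2}" "a' \<in> {..<?d}" "b \<in> {..<2}" "b' \<in> {..<?d}"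
    then have "a * ?d + a' < 2 * ?d" "(a * ?d + a') div ?d = a" "(a * ?d + a') mod ?d = a'"
      "b * ?d + b' < 2 * ?d" "(b * ?d + b') div ?d = b" "(b * ?d + b') mod ?d = b'"
      using mult_add_less[of a 2 a' ?d] mult_add_less[of b 2 b' ?d] by auto
    then show "pauli_string ps $$ (a * ?d + a', b * ?d + b') * cnj (pauli_string qs $$ (a * ?d + a', b * ?d + b')) =
      (pauli_mat p $$ (a, b) * cnj (pauli_mat q $$ (a, b))) *
      (pauli_string ps' $$ (a', b') * cnj (pauli_string qs' $$ (a', b')))"
      using ps qs by (simp add: pauli_string_Cons index_kron del: div_mult_self3 div_mult_self4)
  qed
  also have "\<dots> = (\<Sum>a<2. \<Sum>b<2. \<Sum>a'<?d. \<Sum>b'<?d.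
      (pauli_mat p $$ (a, b) * cnj (pauli_mat q $$ (a, b))) *
      (pauli_string ps' $$ (a', b') * cnj (pauli_string qs' $$ (a', b'))))"
    by (intro sum.cong refl sum.swap)
  also have "\<dots> = (\<Sum>a<2. \<Sum>b<2. pauli_mat p $$ (a, b) * cnj (pauli_mat q $$ (a, b))) *
      (\<Sum>a'<?d. \<Sum>b'<?d. pauli_string ps' $$ (a', b') * cnj (pauli_string qs' $$ (a', b')))"
    unfolding sum_distrib_right unfolding sum_distrib_left ..
  also have "\<dots> = (if ps = qs then 2 ^ Suc r else 0)"
    unfolding pauli_mat_orthogonal Suc.IH[OF ps(2) qs(2)] using ps qs by auto
  finally show ?case .
qed

subsection \<open>The Pauli group\<close>

text \<open>Uniform sampling is over a set of matrices, so counting by labels (phase, string) is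
  legitimate only if no matrix is listed twice.\<close>

lemma pauli_group_bij:
  "bij_betw (\<lambda>(k, ps). \<i> ^ k \<cdot>\<^sub>m pauli_string ps) ({0, 1, 2, 3} \<times> {ps. length ps = r}) (pauli_group r)"
proof -
  have "k = l \<and> ps = qs"
    if eq: "\<i> ^ k \<cdot>\<^sub>m pauli_string ps = \<i> ^ l \<cdot>\<^sub>m pauli_string qs"
      and len: "length ps = r" "length qs = r" and kl: "k \<in> {0, 1, 2, 3}" "l \<in> {0, 1, 2, 3}" for k l ps qs
  proof -
    have ent: "\<i> ^ k * pauli_string ps $$ (a, b) = \<i> ^ l * pauli_string qs $$ (a, b)" if "a < 2 ^ r" "b < 2 ^ r" for a b
      using arg_cong[OF eq, of "\<lambda>A. A $$ (a, b)"] that len by simp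
    \<comment> \<open>Take the Hilbert-Schmidt inner product of both matrices with
      \<open>pauli_string ps\<close>. The left one gives a nonzero value, which forces the strings
      to agree; comparing the values then forces equal phases.\<close>
    have "\<i> ^ k * 2 ^ r = (\<Sum>a<2^r. \<Sum>b<2^r. \<i> ^ k * pauli_string ps $$ (a, b) * cnj (pauli_string ps $$ (a, b)))"
      using pauli_string_orthogonal[OF len(1,1)] by (simp add: sum_distrib_left[symmetric] mult.assoc)
    also have "\<dots> = (\<Sum>a<2^r. \<Sum>b<2^r. \<i> ^ l * pauli_string qs $$ (a, b) * cnj (pauli_string ps $$ (a, b)))"
      by (intro sum.cong refl) (simp add: ent)
    also have "\<dots> = \<i> ^ l * (if qs = ps then 2 ^ r else 0)"
      using pauli_string_orthogonal[OF len(2,1)] by (simp add: sum_distrib_left[symmetric] mult.assoc)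
    finally have *: "\<i> ^ k * 2 ^ r = \<i> ^ l * (if qs = ps then 2 ^ r else 0)" .
    then have "qs = ps" by (auto split: if_splits)
    with * have "\<i> ^ k = \<i> ^ l" by simp
    with kl have "k = l" by (auto simp: power3_eq_cube complex_eq_iff)
    with \<open>qs = ps\<close> show ?thesis by simp
  qed
  then have "inj_on (\<lambda>(k, ps). \<i> ^ k \<cdot>\<^sub>m pauli_string ps) ({0, 1, 2, 3} \<times> {ps. length ps = r})"
    by (intro inj_onI) (auto simp only: mem_Sigma_iff mem_Collect_eq split_paired_all case_prod_conv)
  moreover have "(\<lambda>(k, ps). \<i> ^ k \<cdot>\<^sub>m pauli_string ps) ` ({0, 1, 2, 3} \<times> {ps. length ps = r}) = pauli_group r"
    unfolding pauli_group_def by (auto simp del: insert_iff)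
  ultimately show ?thesis by (simp add: bij_betw_def)
qed

lemma sum_pauli_group:
  "(\<Sum>U\<in>pauli_group r. g U) = (\<Sum>k\<in>{0, 1, 2, 3}. \<Sum>ps | length ps = r. g (\<i> ^ k \<cdot>\<^sub>m pauli_string ps))"
  using sum.reindex_bij_betw[OF pauli_group_bij[of r], of g, symmetric]
  by (simp add: sum.cartesian_product case_prod_unfold del: sum.insert)

lemma finite_pauli_group [simp]: "finite (pauli_group r)"
  using bij_betw_finite[OF pauli_group_bij[of r]] by simp

lemma card_pauli_group: "card (pauli_group r) = 4 * 4 ^ r"
proof -
  have "card {ps :: pauli list. length ps = r} = 4 ^ r"
  proof (induction r)
    case (Suc r)
    have "card {ps :: pauli list. length ps = Suc r} = (\<Sum>p\<in>{PI, PX, PY, PZ}. card {ps :: pauli list. length ps = r})"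
      using sum_length_Suc[of "\<lambda>_. 1 :: nat" r] by (simp del: sum.insert)
    with Suc show ?case by simp
  qed simp
  then show ?thesis
    using bij_betw_same_card[OF pauli_group_bij[of r]] by (simp add: card_cartesian_product)
qed

lemma pauli_group_carrier: "U \<in> pauli_group r \<Longrightarrow> U \<in> carrier_mat (2 ^ r) (2 ^ r)"
  using pauli_string_carrier by (auto simp: pauli_group_def simp del: insert_iff)

lemma smult_smult_mat: "c \<cdot>\<^sub>m (d \<cdot>\<^sub>m A) = (c * d :: 'a :: semigroup_mult) \<cdot>\<^sub>m A"
  by (rule eq_matI) (auto simp: mult.assoc)

lemma one_smult_mat: "(1 :: 'a :: monoid_mult) \<cdot>\<^sub>m A = A"
  by (rule eq_matI) auto

lemma unitary_pauli_group:
  assumes "U \<in> pauli_group r"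
  shows "unitary_mat (2 ^ r) U"
proof -
  obtain k ps where U: "U = \<i> ^ k \<cdot>\<^sub>m pauli_string ps" "length ps = r"
    using assms by (auto simp: pauli_group_def)
  have [simp]: "pauli_string ps \<in> carrier_mat (2 ^ r) (2 ^ r)" using U pauli_string_carrier by auto
  have "cnj \<i> ^ k * \<i> ^ k = 1" by (simp flip: power_mult_distrib)
  moreover have "\<i> ^ k * cnj \<i> ^ k = 1" by (simp flip: power_mult_distrib)
  ultimately show ?thesis
    using pauli_string_mult_self[of ps] U
    by (simp add: unitary_mat_def mat_adjoint_smult mult_smult_distrib[of _ "2^r" "2^r" _ "2^r"]
        mult_smult_assoc_mat[of _ "2^r" "2^r" _ "2^r"] smult_smult_mat one_smult_mat del: complex_cnj_i)
qed

text \<open>A phase cancels against its conjugate, so each string counts four times.\<close>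

lemma pauli_group_completeness:
  assumes "a < 2 ^ r" "b < 2 ^ r" "c < 2 ^ r" "e < 2 ^ r"
  shows "(\<Sum>U\<in>pauli_group r. U $$ (a, c) * cnj (U $$ (b, e))) =
    (if a = b \<and> c = e then of_nat (card (pauli_group r)) / 2 ^ r else 0)"
proof -
  have one: "\<i> ^ k * cnj (\<i> ^ k) = 1" for k by (simp flip: power_mult_distrib)
  have "(\<Sum>U\<in>pauli_group r. U $$ (a, c) * cnj (U $$ (b, e))) =
     (\<Sum>k\<in>{0, 1, 2, 3 :: nat}. \<Sum>ps | length ps = r. (\<i> ^ k * cnj (\<i> ^ k)) * (pauli_string ps $$ (a, c) * cnj (pauli_string ps $$ (b, e))))"
    unfolding sum_pauli_group using assms
    by (intro sum.cong refl) (simp add: ac_simps)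
  also have "\<dots> = 4 * (if a = b \<and> c = e then 2 ^ r else 0)"
    unfolding one using pauli_string_completeness[OF assms] by simp
  \<comment> \<open>The group has 4 * 4^r elements, so 4 * 2^r is its cardinality divided by
    2^r.\<close>
  also have "\<dots> = (if a = b \<and> c = e then of_nat (card (pauli_group r)) / 2 ^ r else 0)"
    using power_mult_distrib[of "2 :: complex" 2 r] by (simp add: card_pauli_group)
  finally show ?thesis .
qed

subsection \<open>Measuring Hermitian involutions\<close>

text \<open>Every column of \<open>R\<close> is fixed by \<open>R\<close> because
  \<open>R * R = R\<close>, hence it is fixed by \<open>Q\<close>.\<close>

lemma orth_projector_absorb:
  assumes "orth_projector N Q" "orth_projector N R"
    and "\<And>v. v \<in> carrier_vec N \<Longrightarrow> R *\<^sub>v v = v \<Longrightarrow> Q *\<^sub>v v = v"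
  shows "Q * R = R"
proof -
  have c: "Q \<in> carrier_mat N N" "R \<in> carrier_mat N N" "R * R = R"
    using assms by (auto simp: orth_projector_def)
  have "col (Q * R) k = col R k" if "k < N" for k
  proof -
    have "R *\<^sub>v col R k = col (R * R) k" using c that by (intro col_mult2[symmetric]) auto
    then have "Q *\<^sub>v col R k = col R k" using c that by (intro assms) auto
    then show ?thesis using col_mult2[OF c(1,2) that] by simp
  qed
  then show ?thesis using c by (intro mat_col_eqI) auto
qed

text \<open>Settles the uniqueness required by the definite description: an orthogonal projector is
  determined by the vectors it fixes.\<close>

lemma eigenprojector_eqI:
  assumes "A \<in> carrier_mat N N" "orth_projector N Q"
    and fixed_iff: "\<And>v. v \<in> carrier_vec N \<Longrightarrow> Q *\<^sub>v v = v \<longleftrightarrow> A *\<^sub>v v = complex_of_real l \<cdot>\<^sub>v v"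
  shows "eigenprojector A l = Q"
  unfolding eigenprojector_def carrier_matD(1)[OF assms(1)]
proof (rule the_equality)
  show "orth_projector N Q \<and> (\<forall>v\<in>carrier_vec N. (Q *\<^sub>v v = v) = (A *\<^sub>v v = complex_of_real l \<cdot>\<^sub>v v))"
    using assms by auto
next
  fix R assume R: "orth_projector N R \<and> (\<forall>v\<in>carrier_vec N. (R *\<^sub>v v = v) = (A *\<^sub>v v = complex_of_real l \<cdot>\<^sub>v v))"
  \<comment> \<open>Projectors with the same fixed vectors absorb each other; taking adjoints in
    \<open>R * Q = Q\<close> gives \<open>Q * R = Q\<close>, so \<open>Q\<close> and
    \<open>R\<close> coincide.\<close>
  then have "Q * R = R" "R * Q = Q"
    using assms by (auto intro!: orth_projector_absorb)
  moreover have "mat_adjoint (R * Q) = Q * R"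
    using R assms by (simp add: orth_projector_def mat_adjoint_mult[of _ N N _ N])
  ultimately show "R = Q" using assms by (simp add: orth_projector_def)
qed

text \<open>What the measurement analysis needs from a signed Pauli string. Both \<Lambda>_j and its
  negative are instances, so one treatment serves both branches of the protocol.\<close>

locale hermitian_involution =
  fixes N :: nat and A :: "complex mat"
  assumes carrier [simp]: "A \<in> carrier_mat N N"
    and hermitian: "mat_adjoint A = A"
    and involution: "A * A = 1\<^sub>m N"
begin

lemma dims [simp]: "dim_row A = N" "dim_col A = N"
  using carrier_matD[OF carrier] by auto

text \<open>For \<open>s = 1\<close> and \<open>s = - 1\<close> this is the spectral projector of
  \<open>A\<close>, whose spectrum lies in {-1, 1}.\<close>

definition proj :: "real \<Rightarrow> complex mat" where
  "proj s = (1 / 2) \<cdot>\<^sub>m (1\<^sub>m N + complex_of_real s \<cdot>\<^sub>m A)"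

lemma proj_carrier: "proj s \<in> carrier_mat N N"
  by (simp add: proj_def)

lemma orth_projector_proj:
  assumes "s = 1 \<or> s = - 1"
  shows "orth_projector N (proj s)"
  unfolding orth_projector_def
proof (intro conjI)
  have cnj_A: "cnj (A $$ (j, i)) = A $$ (i, j)" if "i < N" "j < N" for i j
    using index_mat_adjoint[of i A j] that hermitian by simp
  show "mat_adjoint (proj s) = proj s"
    by (rule eq_matI) (auto simp: proj_def cnj_A)
  have "(1\<^sub>m N + complex_of_real s \<cdot>\<^sub>m A) * (1\<^sub>m N + complex_of_real s \<cdot>\<^sub>m A) =
    (1\<^sub>m N + complex_of_real s \<cdot>\<^sub>m A) + complex_of_real s \<cdot>\<^sub>m (A + complex_of_real s \<cdot>\<^sub>m 1\<^sub>m N)"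
    by (simp add: add_mult_distrib_mat[of _ N N _ _ N] mult_add_distrib_mat[of _ N N _ N]
        mult_smult_distrib[of _ N N _ N] mult_smult_assoc_mat[of _ N N _ N] involution smult_smult_mat)
  \<comment> \<open>Uses s^2 = 1: the square of 1 + s A is twice itself, which makes its half
    idempotent.\<close>
  also have "\<dots> = 2 \<cdot>\<^sub>m (1\<^sub>m N + complex_of_real s \<cdot>\<^sub>m A)"
    using assms by (intro eq_matI) auto
  finally show "proj s * proj s = proj s"
    by (simp add: proj_def mult_smult_distrib[of _ N N _ N] mult_smult_assoc_mat[of _ N N _ N] smult_smult_mat)
qed (rule proj_carrier)

text \<open>The vector (v + s A v)/2 equals v iff s A v = v, that is, iff A v = s v, since s is its
  own inverse.\<close>

lemma eigenprojector_eq_proj: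
  assumes "s = 1 \<or> s = - 1"
  shows "eigenprojector A s = proj s"
proof (rule eigenprojector_eqI[OF carrier orth_projector_proj[OF assms]])
  fix v :: "complex vec" assume v: "v \<in> carrier_vec N"
  have "(proj s *\<^sub>v v) $ i = (v $ i + s * (A *\<^sub>v v) $ i) / 2" if "i < N" for i
  proof -
    have "(proj s *\<^sub>v v) $ i = (\<Sum>j<N. (1 / 2) * ((if i = j then v $ j else 0) + s * (A $$ (i, j) * v $ j)))"
      using v that unfolding proj_def
      by (simp add: scalar_prod_def atLeast0LessThan) (intro sum.cong refl, auto simp: algebra_simps)
    also have "\<dots> = (1 / 2) * (v $ i + s * (\<Sum>j<N. A $$ (i, j) * v $ j))"
      unfolding sum_distrib_left[symmetric] sum.distrib using that by simp
    also have "(\<Sum>j<N. A $$ (i, j) * v $ j) = (A *\<^sub>v v) $ i"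
      using v that by (simp add: scalar_prod_def atLeast0LessThan)
    finally show ?thesis by simp
  qed
  moreover have "proj s *\<^sub>v v \<in> carrier_vec N" "A *\<^sub>v v \<in> carrier_vec N"
    using proj_carrier v by (auto intro!: mult_mat_vec_carrier)
  ultimately have "proj s *\<^sub>v v = v \<longleftrightarrow> (\<forall>i<N. (v $ i + s * (A *\<^sub>v v) $ i) / 2 = v $ i)"
    using v carrier_matD[OF proj_carrier[of s]] by (auto simp: vec_eq_iff simp del: index_mult_mat_vec)
  also have "\<dots> \<longleftrightarrow> (\<forall>i<N. (A *\<^sub>v v) $ i = s * v $ i)"
  proof (intro all_cong)
    fix i
    show "(v $ i + s * (A *\<^sub>v v) $ i) / 2 = v $ i \<longleftrightarrow> (A *\<^sub>v v) $ i = s * v $ i"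
    proof -
      have "- a = b \<longleftrightarrow> a = - b" for a b :: complex by (metis minus_minus)
      then show ?thesis using assms by (auto simp: field_simps simp del: index_mult_mat_vec)
    qed
  qed
  also have "\<dots> \<longleftrightarrow> A *\<^sub>v v = complex_of_real s \<cdot>\<^sub>v v"
    using v \<open>A *\<^sub>v v \<in> carrier_vec N\<close> by (auto simp: vec_eq_iff simp del: index_mult_mat_vec)
  finally show "proj s *\<^sub>v v = v \<longleftrightarrow> A *\<^sub>v v = complex_of_real s \<cdot>\<^sub>v v" .
qed

text \<open>From A v = s v follows v = A A v = s^2 v, so v vanishes. The case matters because the
  outcome distribution is specified at every real number, not only at eigenvalues.\<close>

lemma eigenprojector_eq_zero:
  assumes "s \<noteq> 1" "s \<noteq> - 1"
  shows "eigenprojector A s = 0\<^sub>m N N"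
proof (rule eigenprojector_eqI[OF carrier])
  show "orth_projector N (0\<^sub>m N N)"
    by (auto simp: orth_projector_def intro!: eq_matI)
  fix v :: "complex vec" assume v: "v \<in> carrier_vec N"
  have "v = 0\<^sub>v N" if "A *\<^sub>v v = complex_of_real s \<cdot>\<^sub>v v"
  proof -
    have "v = A *\<^sub>v (A *\<^sub>v v)"
      using v involution assoc_mult_mat_vec[of A N N A N v] by simp
    also have "\<dots> = complex_of_real s \<cdot>\<^sub>v (complex_of_real s \<cdot>\<^sub>v v)"
      using v that by (simp add: mult_mat_vec[of _ N N])
    finally have eq: "v = complex_of_real s \<cdot>\<^sub>v (complex_of_real s \<cdot>\<^sub>v v)" .
    have "v $ i = 0" if "i < N" for i
    proof -
      have "v $ i = (complex_of_real s)\<^sup>2 * v $ i"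
        using arg_cong[OF eq, of "\<lambda>w. w $ i"] v that by (simp add: power2_eq_square)
      moreover have "(complex_of_real s)\<^sup>2 \<noteq> 1"
        using assms by (simp add: power2_eq_1_iff flip: of_real_minus)
          (metis of_real_eq_1_iff of_real_minus minus_equation_iff)
      ultimately show ?thesis by (metis mult_cancel_right1)
    qed
    then show ?thesis using v by (intro eq_vecI) auto
  qed
  moreover have "A *\<^sub>v 0\<^sub>v N = complex_of_real s \<cdot>\<^sub>v 0\<^sub>v N"
    by (intro eq_vecI) auto
  moreover have "0\<^sub>m N N *\<^sub>v v = 0\<^sub>v N" using v by (intro eq_vecI) auto
  ultimately show "0\<^sub>m N N *\<^sub>v v = v \<longleftrightarrow> A *\<^sub>v v = complex_of_real s \<cdot>\<^sub>v v"
    using v by metis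
qed

lemma trace_mult_proj:
  assumes "\<sigma> \<in> carrier_mat N N"
  shows "mat_trace (\<sigma> * proj s) = (mat_trace \<sigma> + s * mat_trace (\<sigma> * A)) / 2"
proof -
  have "\<sigma> * proj s = (1 / 2) \<cdot>\<^sub>m (\<sigma> + complex_of_real s \<cdot>\<^sub>m (\<sigma> * A))"
    using assms by (simp add: proj_def mult_smult_distrib[of _ N N _ N] mult_add_distrib_mat[of _ N N _ N])
  then show ?thesis
    using assms by (simp add: mat_trace_smult[of _ N] mat_trace_add[of _ N])
qed

context
  fixes \<sigma> assumes \<sigma>: "density_matrix N \<sigma>"
begin

text \<open>With t the trace, (1 + t)/2 and (1 - t)/2 are traces of \<sigma> against projectors,
  hence nonnegative.\<close>

lemma trace_mult_bounds:
  "Re (mat_trace (\<sigma> * A)) \<in> {- 1..1}"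
proof -
  have "\<sigma> \<in> carrier_mat N N" "mat_trace \<sigma> = 1" using \<sigma> by (auto simp: density_matrix_def)
  then have "0 \<le> (1 + Re (mat_trace (\<sigma> * A))) / 2" "0 \<le> (1 - Re (mat_trace (\<sigma> * A))) / 2"
    using density_trace_projector_nonneg[OF \<sigma> orth_projector_proj[of 1]]
      density_trace_projector_nonneg[OF \<sigma> orth_projector_proj[of "- 1"]]
    by (simp_all add: trace_mult_proj)
  then show ?thesis by simp
qed

lemma measure_observable_eq:
  "measure_observable A \<sigma> =
    map_pmf (\<lambda>b. if b then 1 else - 1) (bernoulli_pmf ((1 + Re (mat_trace (\<sigma> * A))) / 2))"
proof -
  define t where "t = Re (mat_trace (\<sigma> * A))"
  define f where "f = (\<lambda>b. if b then 1 else - 1 :: real)"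
  define p where "p = map_pmf f (bernoulli_pmf ((1 + t) / 2))"
  have t: "- 1 \<le> t" "t \<le> 1" using trace_mult_bounds by (auto simp: t_def)
  have c: "\<sigma> \<in> carrier_mat N N" "mat_trace \<sigma> = 1" using \<sigma> by (auto simp: density_matrix_def)
  \<comment> \<open>The weight function given to \<open>embed_pmf\<close> is the mass function of
    the known distribution \<open>p\<close>, with both sides zero away from 1 and -1.\<close>
  have "Re (mat_trace (\<sigma> * eigenprojector A l)) = pmf p l" for l
  proof -
    have inj: "inj f" by (auto simp: inj_on_def f_def)
    consider "l = 1" | "l = - 1" | "l \<noteq> 1" "l \<noteq> - 1" by auto
    then show ?thesis
    proof cases
      case 1
      have "pmf p (f True) = (1 + t) / 2" unfolding p_def pmf_map_inj'[OF inj] using t by simp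
      then show ?thesis using 1 c by (simp add: eigenprojector_eq_proj trace_mult_proj t_def f_def)
    next
      case 2
      have "pmf p (f False) = (1 - t) / 2" unfolding p_def pmf_map_inj'[OF inj] using t by (simp add: field_simps)
      then show ?thesis using 2 c by (simp add: eigenprojector_eq_proj trace_mult_proj t_def f_def)
    next
      case 3
      then have "l \<notin> set_pmf p" by (auto simp: p_def f_def)
      then show ?thesis using 3 c by (simp add: eigenprojector_eq_zero pmf_eq_0_set_pmf mat_trace_def)
    qed
  qed
  \<comment> \<open>\<open>embed_pmf\<close> inverts \<open>pmf\<close>, so normalisation of the
    outcome probabilities is inherited from \<open>p\<close> without computing their sum.\<close>
  then show ?thesis
    using type_definition.Rep_inverse[OF td_pmf_embed_pmf, of p]
    by (simp add: measure_observable_def p_def t_def f_def)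
qed

lemma set_measure_observable: "set_pmf (measure_observable A \<sigma>) \<subseteq> {- 1, 1}"
  by (auto simp: measure_observable_eq)

lemma expectation_measure_observable:
  "measure_pmf.expectation (measure_observable A \<sigma>) (\<lambda>x. x) = Re (mat_trace (\<sigma> * A))"
  using trace_mult_bounds by (simp add: measure_observable_eq field_simps)

end

end

lemma hermitian_involution_signed_pauli_string:
  assumes "signed_pauli_string n A"
  shows "hermitian_involution (2 ^ n) A"
proof -
  obtain ps s where A: "length ps = n" "s = 1 \<or> s = - 1" "A = s \<cdot>\<^sub>m pauli_string ps"
    using assms by (auto simp: signed_pauli_string_def)
  then have "pauli_string ps \<in> carrier_mat (2 ^ n) (2 ^ n)" using pauli_string_carrier by auto
  then show ?thesis
    using A pauli_string_mult_self[of ps]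
    by unfold_locales
      (auto simp: mat_adjoint_smult mult_smult_distrib[of _ "2^n" "2^n" _ "2^n"]
        mult_smult_assoc_mat[of _ "2^n" "2^n" _ "2^n"] smult_smult_mat one_smult_mat)
qed

text \<open>Brings the observable measured in the second branch under the same results as the one in
  the first.\<close>

lemma signed_pauli_string_uminus:
  assumes "signed_pauli_string n A"
  shows "signed_pauli_string n (- A)"
proof -
  obtain ps s where A: "length ps = n" "s = 1 \<or> s = - 1" "A = s \<cdot>\<^sub>m pauli_string ps"
    using assms by (auto simp: signed_pauli_string_def)
  then have "- A = (- s) \<cdot>\<^sub>m pauli_string ps" by (intro eq_matI) auto
  with A show ?thesis unfolding signed_pauli_string_def by (metis minus_minus)
qed

subsection \<open>The global unitary attains the minimum in the observational ergotropy\<close>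

text \<open>The partial sums \<open>\<alpha>\<close> and \<open>\<beta> l = E l * q l - \<alpha> l\<close> are a feasible dual solution of the transport problem,
  tight on the diagonal.\<close>

lemma sum_rearrangement_le_doubly_stochastic:
  fixes E q :: "nat \<Rightarrow> real"
  assumes E: "\<And>k l. k \<le> l \<Longrightarrow> l < N \<Longrightarrow> E k \<le> E l"
    and q: "\<And>k l. k \<le> l \<Longrightarrow> l < N \<Longrightarrow> q l \<le> q k"
    and D: "\<And>k l. k < N \<Longrightarrow> l < N \<Longrightarrow> D k l \<ge> 0"
    and row: "\<And>k. k < N \<Longrightarrow> (\<Sum>l<N. D k l) = 1"
    and col: "\<And>l. l < N \<Longrightarrow> (\<Sum>k<N. D k l) = 1"
  shows "(\<Sum>k<N. E k * q k) \<le> (\<Sum>k<N. \<Sum>l<N. D k l * (E k * q l))"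
proof -
  define \<alpha> where "\<alpha> k = (\<Sum>m<k. (E (Suc m) - E m) * q m)" for k
  have \<alpha>_Suc: "\<alpha> (Suc k) = \<alpha> k + (E (Suc k) - E k) * q k" for k by (simp add: \<alpha>_def)
  have dual: "\<alpha> k + (E l * q l - \<alpha> l) \<le> E k * q l" if kl: "k < N" "l < N" for k l
  \<comment> \<open>Equality holds at \<open>k = l\<close>. Moving \<open>k\<close> one place from
    there changes the two sides by the same energy gap, weighted by \<open>q k\<close> and by
    \<open>q l\<close> respectively; as \<open>q\<close> is non-increasing, the inequality survives
    in either direction.\<close>
  proof (cases "l \<le> k")
    case True
    then show ?thesis using kl(1)
    proof (induction k rule: dec_induct)
      case (step k)
      have "(E (Suc k) - E k) * q k \<le> (E (Suc k) - E k) * q l"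
        using step by (intro mult_left_mono) (auto intro: E q)
      with step show ?case by (simp add: \<alpha>_Suc algebra_simps)
    qed simp
  next
    case False
    then have "k \<le> l" by simp
    then show ?thesis
    proof (induction k rule: inc_induct)
      case (step k)
      have "(E (Suc k) - E k) * q l \<le> (E (Suc k) - E k) * q k"
        using step kl by (intro mult_left_mono) (auto intro: E q)
      with step show ?case by (simp add: \<alpha>_Suc algebra_simps)
    qed simp
  qed
  have "(\<Sum>k<N. \<Sum>l<N. D k l * (E k * q l)) \<ge> (\<Sum>k<N. \<Sum>l<N. D k l * (\<alpha> k + (E l * q l - \<alpha> l)))"
    using D dual by (intro sum_mono mult_left_mono) auto
  also have "(\<Sum>k<N. \<Sum>l<N. D k l * (\<alpha> k + (E l * q l - \<alpha> l))) =
      (\<Sum>k<N. (\<Sum>l<N. D k l) * \<alpha> k) + (\<Sum>k<N. \<Sum>l<N. D k l * (E l * q l - \<alpha> l))"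
    by (simp add: ring_distribs sum.distrib sum_distrib_right sum_subtractf)
  also have "(\<Sum>k<N. \<Sum>l<N. D k l * (E l * q l - \<alpha> l)) = (\<Sum>l<N. (\<Sum>k<N. D k l) * (E l * q l - \<alpha> l))"
    unfolding sum_distrib_right by (rule sum.swap)
  also have "(\<Sum>k<N. (\<Sum>l<N. D k l) * \<alpha> k) + \<dots> = (\<Sum>k<N. E k * q k)"
    using row col by (simp add: sum_subtractf)
  finally show ?thesis .
qed

section \<open>Orthonormal bases as unitary matrices, and diagonalisation\<close>

definition basis_mat :: "nat \<Rightarrow> (nat \<Rightarrow> complex vec) \<Rightarrow> complex mat" where
  "basis_mat N f = mat N N (\<lambda>(i, k). f k $ i)"

definition real_diag :: "nat \<Rightarrow> (nat \<Rightarrow> real) \<Rightarrow> complex mat" where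
  "real_diag N E = mat N N (\<lambda>(i, j). if i = j then complex_of_real (E i) else 0)"

lemma basis_mat_carrier [simp]: "basis_mat N f \<in> carrier_mat N N"
  and real_diag_carrier [simp]: "real_diag N E \<in> carrier_mat N N"
  and basis_mat_dim [simp]: "dim_row (basis_mat N f) = N" "dim_col (basis_mat N f) = N"
  and real_diag_dim [simp]: "dim_row (real_diag N E) = N" "dim_col (real_diag N E) = N"
  and index_basis_mat [simp]: "i < N \<Longrightarrow> k < N \<Longrightarrow> basis_mat N f $$ (i, k) = f k $ i"
  and index_real_diag [simp]: "i < N \<Longrightarrow> k < N \<Longrightarrow>
    real_diag N E $$ (i, k) = (if i = k then complex_of_real (E i) else 0)"
  by (auto simp: basis_mat_def real_diag_def)

lemma unitary_basis_mat:
  assumes "orthonormal_basis N f"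
  shows "unitary_mat N (basis_mat N f)"
proof -
  have "mat_adjoint (basis_mat N f) * basis_mat N f = 1\<^sub>m N"
  proof (rule eq_matI)
    fix k l assume "k < dim_row (1\<^sub>m N :: complex mat)" "l < dim_col (1\<^sub>m N :: complex mat)"
    then have kl: "k < N" "l < N" by auto
    have "(mat_adjoint (basis_mat N f) * basis_mat N f) $$ (k, l) = (\<Sum>i<N. f l $ i * cnj (f k $ i))"
      using kl by (subst index_mult_mat_sum[of _ N N _ N]) (auto intro!: sum.cong)
    also have "\<dots> = f l \<bullet>c f k"
      using assms kl by (intro cscalar_prod_sum[symmetric]) (auto simp: orthonormal_basis_def)
    finally show "(mat_adjoint (basis_mat N f) * basis_mat N f) $$ (k, l) = 1\<^sub>m N $$ (k, l)"
      using assms kl by (auto simp: orthonormal_basis_def)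
  qed auto
  moreover from this have "basis_mat N f * mat_adjoint (basis_mat N f) = 1\<^sub>m N"
    by (rule mat_mult_left_right_inverse[rotated 2]) auto
  ultimately show ?thesis by (simp add: unitary_mat_def)
qed

text \<open>Serves both for eigenvectors, where \<open>g k\<close> is a multiple of
  \<open>f k\<close>, and for the global unitary, which carries one orthonormal basis to
  another.\<close>

lemma mult_basis_mat:
  assumes "A \<in> carrier_mat N N" "orthonormal_basis N f" "\<And>k. k < N \<Longrightarrow> A *\<^sub>v f k = g k"
  shows "A * basis_mat N f = basis_mat N g"
proof (rule eq_matI)
  fix i k assume "i < dim_row (basis_mat N g)" "k < dim_col (basis_mat N g)"
  then have ik: "i < N" "k < N" by auto
  have "f k \<in> carrier_vec N" using assms ik by (auto simp: orthonormal_basis_def)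
  then have "(A * basis_mat N f) $$ (i, k) = (A *\<^sub>v f k) $ i"
    using ik assms(1) by (subst index_mult_mat_sum[of _ N N _ N]) (auto simp: scalar_prod_def atLeast0LessThan)
  then show "(A * basis_mat N f) $$ (i, k) = basis_mat N g $$ (i, k)" using ik assms by simp
qed (use assms in auto)

text \<open>Columnwise the eigenvalue equations read A F = F D; multiplying by the adjoint of the
  unitary F isolates A.\<close>

lemma eigenbasis_diagonalizes:
  assumes A: "A \<in> carrier_mat N N" and f: "orthonormal_basis N f"
    and eig: "\<And>k. k < N \<Longrightarrow> A *\<^sub>v f k = complex_of_real (E k) \<cdot>\<^sub>v f k"
  shows "A = basis_mat N f * real_diag N E * mat_adjoint (basis_mat N f)"
proof -
  let ?F = "basis_mat N f"
  have F: "?F * mat_adjoint ?F = 1\<^sub>m N" using unitary_basis_mat[OF f] by (auto simp: unitary_mat_def)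
  have "A * ?F = basis_mat N (\<lambda>k. complex_of_real (E k) \<cdot>\<^sub>v f k)"
    using A f eig by (rule mult_basis_mat)
  also have "\<dots> = ?F * real_diag N E"
  proof (rule eq_matI)
    fix i k assume "i < dim_row (?F * real_diag N E)" "k < dim_col (?F * real_diag N E)"
    then have ik: "i < N" "k < N" by auto
    have "f k \<in> carrier_vec N" using f ik by (auto simp: orthonormal_basis_def)
    then show "basis_mat N (\<lambda>k. complex_of_real (E k) \<cdot>\<^sub>v f k) $$ (i, k) = (?F * real_diag N E) $$ (i, k)"
      using ik by (subst index_mult_mat_sum[of _ N N _ N]) (auto simp: if_distrib cong: if_cong)
  qed auto
  finally have "A * ?F * mat_adjoint ?F = ?F * real_diag N E * mat_adjoint ?F" by simp
  moreover have "A * ?F * mat_adjoint ?F = A"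
    using A F by (simp add: assoc_mult_mat[of _ N N _ N _ N] mult_carrier_mat[of _ N N _ N])
  ultimately show ?thesis by simp
qed

text \<open>The vector lies in the range of \<open>P i\<close>, so all other projectors annihilate
  it by mutual orthogonality.\<close>

lemma coarse_state_eigenvector:
  assumes "coarse_graining N M d P" "i < M" "v \<in> carrier_vec N" "P i *\<^sub>v v = v"
  shows "coarse_state N M d P \<rho> *\<^sub>v v = complex_of_real (outcome_prob (P i) \<rho> / real d) \<cdot>\<^sub>v v"
proof (rule eq_vecI)
  have P: "P j \<in> carrier_mat N N" if "j < M" for j
    using assms that by (auto simp: coarse_graining_def orth_projector_def)
  have Pv: "P j *\<^sub>v v = (if j = i then v else 0\<^sub>v N)" if "j < M" for j
  proof (cases "j = i")
    case False
    have "P j *\<^sub>v v = P j * P i *\<^sub>v v"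
      using assms P[OF that] P[OF \<open>i < M\<close>] by (subst assoc_mult_mat_vec[of _ N N _ N]) auto
    also have "P j * P i = 0\<^sub>m N N"
      using assms that False by (auto simp: coarse_graining_def)
    also have "\<dots> *\<^sub>v v = 0\<^sub>v N" using assms by (intro eq_vecI) auto
    finally show ?thesis using False by simp
  qed (use assms in simp)
  fix a assume "a < dim_vec (complex_of_real (outcome_prob (P i) \<rho> / real d) \<cdot>\<^sub>v v)"
  then have a: "a < N" using assms by auto
  let ?c = "\<lambda>j. complex_of_real (outcome_prob (P j) \<rho> / real d)"
  have "(coarse_state N M d P \<rho> *\<^sub>v v) $ a = (\<Sum>b<N. \<Sum>j<M. ?c j * (P j $$ (a, b) * v $ b))"
    using a assms(3) carrier_matD[OF P]
    by (auto simp: coarse_state_def scalar_prod_def atLeast0LessThan sum_distrib_right mult.assoc intro!: sum.cong)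
  also have "\<dots> = (\<Sum>j<M. ?c j * (\<Sum>b<N. P j $$ (a, b) * v $ b))"
    by (simp add: sum.swap[of _ "{..<N}"] sum_distrib_left)
  also have "\<dots> = (\<Sum>j<M. ?c j * (P j *\<^sub>v v) $ a)"
    using a assms(3) carrier_matD[OF P] by (intro sum.cong refl) (auto simp: scalar_prod_def atLeast0LessThan)
  also have "\<dots> = (\<Sum>j<M. if j = i then ?c j * v $ a else 0)"
    using Pv a by (intro sum.cong refl) auto
  also have "\<dots> = (?c i \<cdot>\<^sub>v v) $ a" using assms a by simp
  finally show "(coarse_state N M d P \<rho> *\<^sub>v v) $ a = (?c i \<cdot>\<^sub>v v) $ a" .
qed (use assms in \<open>auto simp: coarse_state_def\<close>)

text \<open>Turns the energy into a form bilinear in the two spectra, with the squared moduli of the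
  entries of \<open>W\<close> as weights. For unitary \<open>W\<close> these weights are doubly
  stochastic, which is where the rearrangement inequality enters.\<close>

lemma trace_diag_unitary:
  assumes W: "W \<in> carrier_mat N N"
  shows "Re (mat_trace (real_diag N E * (W * real_diag N q * mat_adjoint W))) =
    (\<Sum>k<N. \<Sum>l<N. (cmod (W $$ (k, l)))\<^sup>2 * (E k * q l))"
proof -
  let ?X = "W * real_diag N q * mat_adjoint W"
  have WD: "(W * real_diag N q) $$ (k, l) = W $$ (k, l) * q l" if "k < N" "l < N" for k l
    using that W by (subst index_mult_mat_sum[of _ N N _ N]) (auto simp: if_distrib cong: if_cong)
  have X: "?X $$ (k, k) = (\<Sum>l<N. complex_of_real ((cmod (W $$ (k, l)))\<^sup>2 * q l))" if "k < N" for k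
    using that W WD complex_norm_square
    by (subst index_mult_mat_sum[of _ N N _ N]) (auto simp: mult_ac intro!: sum.cong)
  have "mat_trace (real_diag N E * ?X) = (\<Sum>k<N. E k * ?X $$ (k, k))"
    using W by (subst mat_trace_mult[of _ N N]) (auto simp: mult_carrier_mat[of _ N N _ N] if_distrib if_distribR cong: if_cong simp del: index_mult_mat(1))
  also have "\<dots> = (\<Sum>k<N. \<Sum>l<N. complex_of_real ((cmod (W $$ (k, l)))\<^sup>2 * (E k * q l)))"
    using X by (simp add: sum_distrib_left mult_ac del: index_mult_mat(1))
  also have "Re \<dots> = (\<Sum>k<N. \<Sum>l<N. (cmod (W $$ (k, l)))\<^sup>2 * (E k * q l))"
    by (simp only: Re_sum Re_complex_of_real)
  finally show ?thesis .
qed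

lemma unitary_mat_row_sum:
  assumes "unitary_mat N W" "k < N"
  shows "(\<Sum>l<N. (cmod (W $$ (k, l)))\<^sup>2) = 1" (is "?s = 1")
proof -
  have W: "W \<in> carrier_mat N N" "W * mat_adjoint W = 1\<^sub>m N" using assms by (auto simp: unitary_mat_def)
  have "complex_of_real ?s = (W * mat_adjoint W) $$ (k, k)"
    using W(1) assms(2) complex_norm_square by (subst index_mult_mat_sum[of _ N N _ N]) (auto intro!: sum.cong)
  also have "\<dots> = 1" using W assms by simp
  finally show ?thesis using of_real_eq_1_iff by blast
qed

lemma unitary_mat_col_sum:
  assumes "unitary_mat N W" "l < N"
  shows "(\<Sum>k<N. (cmod (W $$ (k, l)))\<^sup>2) = 1"
proof -
  have W: "W \<in> carrier_mat N N" using assms by (auto simp: unitary_mat_def)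
  have "(\<Sum>k<N. (cmod (mat_adjoint W $$ (l, k)))\<^sup>2) = 1"
    using unitary_mat_adjoint[OF assms(1)] assms(2) by (rule unitary_mat_row_sum)
  then show ?thesis using W assms(2) by simp
qed

text \<open>Relative to an eigenbasis of the coarse-grained state and one of \<open>H\<close>, any
  unitary gives a doubly stochastic weight matrix, and \<open>Ugl\<close> gives the identity matrix.
  With the two spectra oppositely ordered, the identity is optimal.\<close>

lemma global_unitary_minimal:
  assumes cg: "coarse_graining N M d P" and N: "N = M * d" and H: "H \<in> carrier_mat N N"
    and gl: "global_unitary N M d H P \<rho> Ugl" and U: "unitary_mat N U"
  shows "Re (mat_trace (H * Ugl * coarse_state N M d P \<rho> * mat_adjoint Ugl)) \<le>
    Re (mat_trace (H * U * coarse_state N M d P \<rho> * mat_adjoint U))"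
proof -
  obtain \<pi> f e and E :: "nat \<Rightarrow> real" where Ugl: "unitary_mat N Ugl" and \<pi>: "bij_betw \<pi> {..<M} {..<M}"
    and p_mono: "\<forall>i<M. \<forall>j<M. i \<le> j \<longrightarrow> outcome_prob (P (\<pi> j)) \<rho> \<le> outcome_prob (P (\<pi> i)) \<rho>"
    and f: "orthonormal_basis N f"
    and Pf: "\<forall>i<M. \<forall>k<d. P (\<pi> i) *\<^sub>v f (i * d + k) = f (i * d + k)"
    and e: "orthonormal_basis N e"
    and He: "\<forall>k<N. H *\<^sub>v e k = complex_of_real (E k) \<cdot>\<^sub>v e k"
    and E_mono: "\<forall>k<N. \<forall>l<N. k \<le> l \<longrightarrow> E k \<le> E l"
    and fe: "\<forall>k<N. Ugl *\<^sub>v f k = e k"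
    using gl unfolding global_unitary_def by (elim conjE exE) (rule that; assumption)
  \<comment> \<open>The eigenvalue of the coarse-grained state at \<open>f k\<close>:
    \<open>k div d\<close> is the block containing position \<open>k\<close>. Since \<pi> sorts the
    blocks, \<open>q\<close> is non-increasing.\<close>
  define q where "q k = outcome_prob (P (\<pi> (k div d))) \<rho> / real d" for k
  define F where "F = basis_mat N f"
  define G where "G = basis_mat N e"
  let ?R = "coarse_state N M d P \<rho>"
  have uF: "unitary_mat N F" and uG: "unitary_mat N G"
    using f e by (auto simp: F_def G_def intro: unitary_basis_mat)
  then have F: "F \<in> carrier_mat N N" and G: "G \<in> carrier_mat N N" "mat_adjoint G * G = 1\<^sub>m N"
    by (auto simp: unitary_mat_def)
  have div_less: "k div d < M" if "k < N" for k using that N by (simp add: less_mult_imp_div_less)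
  have R: "?R = F * real_diag N q * mat_adjoint F"
    unfolding F_def
  proof (rule eigenbasis_diagonalizes[OF _ f])
    fix k assume k: "k < N"
    then have "P (\<pi> (k div d)) *\<^sub>v f k = f k"
      using Pf[rule_format, OF div_less[OF k], of "k mod d"] div_mod_less[of k M d] N by simp
    moreover have "\<pi> (k div d) < M" using bij_betwE[OF \<pi>] div_less[OF k] by auto
    moreover have "f k \<in> carrier_vec N" using f k by (auto simp: orthonormal_basis_def)
    ultimately show "?R *\<^sub>v f k = complex_of_real (q k) \<cdot>\<^sub>v f k"
      unfolding q_def by (intro coarse_state_eigenvector[OF cg])
  qed (simp add: coarse_state_def)
  have H_eq: "H = G * real_diag N E * mat_adjoint G"
    unfolding G_def by (rule eigenbasis_diagonalizes[OF H e]) (use He in simp)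
  have energy: "Re (mat_trace (H * V * ?R * mat_adjoint V)) =
      (\<Sum>k<N. \<Sum>l<N. (cmod ((mat_adjoint G * V * F) $$ (k, l)))\<^sup>2 * (E k * q l))"
    if V: "V \<in> carrier_mat N N" for V
  proof -
    \<comment> \<open>The matrix of \<open>V\<close> from the basis \<open>f\<close> to the basis
      \<open>e\<close>. Cyclicity moves the leading \<open>G\<close> to the end, where it completes
      the adjoint of \<open>W\<close>.\<close>
    define W where "W = mat_adjoint G * V * F"
    have W: "W \<in> carrier_mat N N" using V F G by (auto simp: W_def)
    have W': "mat_adjoint W = mat_adjoint F * (mat_adjoint V * G)"
      using V F G by (simp add: W_def mat_adjoint_mult[of _ N N _ N])
    let ?Y = "real_diag N E * mat_adjoint G * V * F * real_diag N q * mat_adjoint F * mat_adjoint V"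
    have "mat_trace (H * V * ?R * mat_adjoint V) = mat_trace (G * ?Y)"
      unfolding H_eq R using V F G by (simp add: assoc_mult_mat[of _ N N _ N _ N] mult_carrier_mat[of _ N N _ N])
    also have "\<dots> = mat_trace (?Y * G)"
      using V F G by (intro mat_trace_comm[of _ N N]) (auto simp: mult_carrier_mat[of _ N N _ N])
    also have "?Y * G = real_diag N E * (W * real_diag N q * mat_adjoint W)"
      unfolding W' using V F G by (simp add: W_def assoc_mult_mat[of _ N N _ N _ N] mult_carrier_mat[of _ N N _ N])
    finally show ?thesis
      unfolding W_def[symmetric] using trace_diag_unitary[OF W] by simp
  qed
  have "Ugl * F = G"
    unfolding F_def G_def using Ugl f fe by (intro mult_basis_mat) (auto simp: unitary_mat_def)
  then have "mat_adjoint G * Ugl * F = 1\<^sub>m N"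
    using F G Ugl by (simp add: unitary_mat_def assoc_mult_mat[of _ N N _ N _ N] mult_carrier_mat[of _ N N _ N])
  then have "Re (mat_trace (H * Ugl * ?R * mat_adjoint Ugl)) =
     (\<Sum>k<N. \<Sum>l<N. (cmod (1\<^sub>m N $$ (k, l)))\<^sup>2 * (E k * q l))"
    using energy[of Ugl] Ugl by (simp add: unitary_mat_def)
  also have "\<dots> = (\<Sum>k<N. \<Sum>l<N. if l = k then E k * q l else 0)"
    by (intro sum.cong refl) auto
  also have "\<dots> = (\<Sum>k<N. E k * q k)" by simp
  also have "\<dots> \<le> (\<Sum>k<N. \<Sum>l<N. (cmod ((mat_adjoint G * U * F) $$ (k, l)))\<^sup>2 * (E k * q l))"
  proof (rule sum_rearrangement_le_doubly_stochastic)
    have uW: "unitary_mat N (mat_adjoint G * U * F)"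
      by (intro unitary_mat_mult unitary_mat_adjoint uG U uF)
    show "(\<Sum>l<N. (cmod ((mat_adjoint G * U * F) $$ (k, l)))\<^sup>2) = 1" if "k < N" for k
      using uW that by (rule unitary_mat_row_sum)
    show "(\<Sum>k<N. (cmod ((mat_adjoint G * U * F) $$ (k, l)))\<^sup>2) = 1" if "l < N" for l
      using uW that by (rule unitary_mat_col_sum)
    show "q l \<le> q k" if "k \<le> l" "l < N" for k l
      unfolding q_def using that div_less[of k] div_less[of l]
      by (intro divide_right_mono p_mono[rule_format] div_le_mono) auto
  qed (use E_mono in auto)
  also have "\<dots> = Re (mat_trace (H * U * ?R * mat_adjoint U))"
    using energy[of U] U by (simp add: unitary_mat_def)
  finally show ?thesis .
qed

text \<open>A \<open>LEAST\<close> over the reals can be evaluated because \<open>Ugl\<close> is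
  itself a competitor, so the lower bound is attained.\<close>

lemma obs_ergotropy_global_unitary:
  assumes "coarse_graining N M d P" "N = M * d" "H \<in> carrier_mat N N"
    and "global_unitary N M d H P \<rho> Ugl"
  shows "obs_ergotropy N M d H P \<rho> =
    Re (mat_trace (H * \<rho>)) - Re (mat_trace (H * Ugl * coarse_state N M d P \<rho> * mat_adjoint Ugl))"
proof -
  have "unitary_mat N Ugl" using assms by (auto simp: global_unitary_def)
  then have "(LEAST x. \<exists>U. unitary_mat N U \<and>
        x = Re (mat_trace (H * U * coarse_state N M d P \<rho> * mat_adjoint U))) =
     Re (mat_trace (H * Ugl * coarse_state N M d P \<rho> * mat_adjoint Ugl))"
    by (intro Least_equality) (auto intro: global_unitary_minimal[OF assms])
  then show ?thesis by (simp add: obs_ergotropy_def)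
qed

subsection \<open>Pauli twirling\<close>

lemma evolve_mult:
  assumes "U \<in> carrier_mat N N" "V \<in> carrier_mat N N" "\<sigma> \<in> carrier_mat N N"
  shows "evolve (U * V) \<sigma> = evolve U (evolve V \<sigma>)"
  using assms
  by (simp add: evolve_def mat_adjoint_mult[of _ N N _ N] assoc_mult_mat[of _ N N _ N _ N]
      mult_carrier_mat[of _ N N _ N])

lemma evolve_carrier:
  "U \<in> carrier_mat N N \<Longrightarrow> \<sigma> \<in> carrier_mat N N \<Longrightarrow> evolve U \<sigma> \<in> carrier_mat N N"
  by (simp add: evolve_def mult_carrier_mat[of _ N N _ N])

lemma evolve_mat_sum:
  assumes "U \<in> carrier_mat N N" "\<And>s. s \<in> S \<Longrightarrow> F s \<in> carrier_mat N N"
  shows "evolve U (mat_sum N F S) = mat_sum N (\<lambda>s. evolve U (F s)) S"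
  unfolding evolve_def using assms
  by (simp add: mult_mat_sum mat_sum_mult mult_carrier_mat[of _ N N _ N])

section \<open>Block structure of matrices whose indices are split by \<open>M * d\<close>\<close>

context
  fixes N M d :: nat
  assumes N: "N = M * d" and d: "d > 0"
begin

lemma div_less: "x < N \<Longrightarrow> x div d < M" and mod_less: "x < N \<Longrightarrow> x mod d < d"
  using N d div_mod_less[of x M d] by auto

lemma block_carrier: "kron (matrix_unit M i) (1\<^sub>m d) \<in> carrier_mat N N"
  using kron_carrier[of "matrix_unit M i" M M "1\<^sub>m d" d d] by (simp add: matrix_unit_def N)

lemma index_block:
  assumes "x < N" "y < N"
  shows "kron (matrix_unit M i) (1\<^sub>m d) $$ (x, y) = (if x = y \<and> x div d = i then 1 else 0)"
  using assms div_less mod_less eq_iff_div_mod[of x y d]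
  by (auto simp: index_kron matrix_unit_def N)

lemma index_block_conjugate:
  assumes A: "A \<in> carrier_mat N N" and xy: "x < N" "y < N"
  shows "(kron (matrix_unit M i) (1\<^sub>m d) * A * kron (matrix_unit M i) (1\<^sub>m d)) $$ (x, y) =
    (if x div d = i \<and> y div d = i then A $$ (x, y) else 0)"
proof -
  let ?D = "kron (matrix_unit M i) (1\<^sub>m d)"
  have DA: "(?D * A) $$ (x, z) = (if x div d = i then A $$ (x, z) else 0)" if "z < N" for z
  proof -
    have "(?D * A) $$ (x, z) = (\<Sum>l<N. if l = x then (if x div d = i then A $$ (x, z) else 0) else 0)"
      unfolding index_mult_mat_sum[OF block_carrier A xy(1) that]
      using xy by (intro sum.cong refl) (auto simp: index_block)
    then show ?thesis using xy by simp
  qed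
  have "(?D * A * ?D) $$ (x, y) = (\<Sum>l<N. (?D * A) $$ (x, l) * ?D $$ (l, y))"
    using xy A block_carrier by (intro index_mult_mat_sum) (auto simp: mult_carrier_mat[of _ N N _ N])
  also have "\<dots> = (\<Sum>l<N. if l = y then (if x div d = i \<and> y div d = i then A $$ (x, y) else 0) else 0)"
    using xy by (intro sum.cong refl) (auto simp: index_block DA simp del: index_mult_mat(1))
  finally show ?thesis using xy by simp
qed

text \<open>The unitary acts within each block, so block (i, j) of \<open>B\<close> is conjugated by
  \<open>U\<close> separately. The offsets \<open>x div d * d\<close> and \<open>y div d * d\<close>
  locate that block.\<close>

lemma index_kron_one_conjugate:
  assumes U: "U \<in> carrier_mat d d" and B: "B \<in> carrier_mat N N" and xy: "x < N" "y < N"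
  shows "(kron (1\<^sub>m M) U * B * mat_adjoint (kron (1\<^sub>m M) U)) $$ (x, y) =
    (\<Sum>c<d. \<Sum>e<d. B $$ (x div d * d + c, y div d * d + e) * (U $$ (x mod d, c) * cnj (U $$ (y mod d, e))))"
proof -
  let ?K = "kron (1\<^sub>m M) U"
  have K: "?K \<in> carrier_mat N N" using U kron_carrier[of "1\<^sub>m M" M M U d d] by (simp add: N)
  have index_K: "?K $$ (x, i * d + c) = (if i = x div d then U $$ (x mod d, c) else 0)"
    if "x < N" "i < M" "c < d" for x i c
    using that U div_less[of x] mult_add_less[of i M c d] by (auto simp: index_kron N)
  have row: "(\<Sum>z<N. ?K $$ (x, z) * g z) = (\<Sum>c<d. U $$ (x mod d, c) * g (x div d * d + c))"
    if "x < N" for x and g :: "nat \<Rightarrow> complex"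
  proof -
    have "(\<Sum>z<N. ?K $$ (x, z) * g z) =
      (\<Sum>i<M. if i = x div d then (\<Sum>c<d. U $$ (x mod d, c) * g (i * d + c)) else 0)"
      unfolding N sum_lessThan_times using that
      by (intro sum.cong refl) (auto simp: index_K)
    then show ?thesis using div_less[OF that] by simp
  qed
  have "(?K * B * mat_adjoint ?K) $$ (x, y) = (\<Sum>w<N. (?K * B) $$ (x, w) * cnj (?K $$ (y, w)))"
  proof -
    have "?K * B \<in> carrier_mat N N" "mat_adjoint ?K \<in> carrier_mat N N"
      using K B by (simp_all add: mult_carrier_mat[of _ N N _ N])
    then show ?thesis
      unfolding index_mult_mat_sum[OF _ _ xy] using carrier_matD[OF K] xy
      by (subst index_mult_mat_sum[OF _ _ xy]) (auto intro!: sum.cong simp del: index_mult_mat(1) kron_dim)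
  qed
  \<comment> \<open>Conjugating the whole sum lets the fact \<open>row\<close> contract the
    right-hand factor as well.\<close>
  also have "\<dots> = cnj (\<Sum>w<N. ?K $$ (y, w) * cnj ((?K * B) $$ (x, w)))"
    by (simp add: mult.commute)
  also have "\<dots> = (\<Sum>e<d. cnj (U $$ (y mod d, e)) * (?K * B) $$ (x, y div d * d + e))"
    unfolding row[OF xy(2)] by simp
  also have "\<dots> = (\<Sum>e<d. cnj (U $$ (y mod d, e)) * (\<Sum>c<d. U $$ (x mod d, c) * B $$ (x div d * d + c, y div d * d + e)))"
  proof (intro sum.cong refl)
    fix e assume "e \<in> {..<d}"
    then have w: "y div d * d + e < N" using mult_add_less div_less[OF xy(2)] by (simp add: N)
    show "cnj (U $$ (y mod d, e)) * (?K * B) $$ (x, y div d * d + e) =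
      cnj (U $$ (y mod d, e)) * (\<Sum>c<d. U $$ (x mod d, c) * B $$ (x div d * d + c, y div d * d + e))"
      unfolding index_mult_mat_sum[OF K B xy(1) w] row[OF xy(1)] ..
  qed
  also have "\<dots> = (\<Sum>e<d. \<Sum>c<d. B $$ (x div d * d + c, y div d * d + e) * (U $$ (x mod d, c) * cnj (U $$ (y mod d, e))))"
    by (simp add: sum_distrib_left mult_ac)
  also have "\<dots> = (\<Sum>c<d. \<Sum>e<d. B $$ (x div d * d + c, y div d * d + e) * (U $$ (x mod d, c) * cnj (U $$ (y mod d, e))))"
    by (rule sum.swap)
  finally show ?thesis .
qed

end

text \<open>In the frame of \<open>V\<close> the projectors are blocks of the identity, and
  completeness of the Pauli group replaces each diagonal block of the measured state by its
  normalised trace. The sum over the group stands for the average, hence the cardinality on the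
  right.\<close>

lemma pauli_twirl:
  assumes N: "N = M * 2 ^ r" and cg: "coarse_graining N M (2 ^ r) P"
    and bi: "block_identification N M (2 ^ r) P V" and \<rho>: "density_matrix N \<rho>"
  shows "mat_sum N (\<lambda>U. evolve (V * kron (1\<^sub>m M) U * mat_adjoint V) (post_measurement_state N M P \<rho>)) (pauli_group r) =
    of_nat (card (pauli_group r)) \<cdot>\<^sub>m coarse_state N M (2 ^ r) P \<rho>"
proof -
  let ?d = "2 ^ r :: nat"
  let ?c = "of_nat (card (pauli_group r)) :: complex"
  have d: "?d > 0" by simp
  note idx = index_block[OF N d] index_block_conjugate[OF N d]
  have V: "V \<in> carrier_mat N N" "mat_adjoint V * V = 1\<^sub>m N"
    and P: "\<And>i. i < M \<Longrightarrow> P i = evolve V (kron (matrix_unit M i) (1\<^sub>m ?d))"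
    using bi by (auto simp: block_identification_def unitary_mat_def evolve_def)
  have VV: "mat_adjoint V * (V * X) = X" if "X \<in> carrier_mat N N" for X
    using that V assoc_mult_mat[of "mat_adjoint V" N N V N X N] by simp
  have r: "\<rho> \<in> carrier_mat N N" "mat_adjoint \<rho> = \<rho>" using \<rho> by (auto simp: density_matrix_def)
  let ?D = "\<lambda>i. kron (matrix_unit M i) (1\<^sub>m ?d)"
  have D: "?D i \<in> carrier_mat N N" for i by (rule block_carrier[OF N d])
  define \<rho>' where "\<rho>' = mat_adjoint V * \<rho> * V"
  have \<rho>': "\<rho>' \<in> carrier_mat N N" using V r by (simp add: \<rho>'_def mult_carrier_mat[of _ N N _ N])
  have "mat_adjoint \<rho>' = \<rho>'"
    using V r by (simp add: \<rho>'_def mat_adjoint_mult[of _ N N _ N] assoc_mult_mat[of _ N N _ N _ N] mult_carrier_mat[of _ N N _ N])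
  then have real_diag: "Im (\<rho>' $$ (x, x)) = 0" if "x < N" for x
    using index_mat_adjoint[of x \<rho>' x] \<rho>' that by (simp add: complex_eq_iff)
  \<comment> \<open>The measured state in the frame of \<open>V\<close>: \<rho>' with its
    off-diagonal blocks deleted.\<close>
  define B where "B = mat_sum N (\<lambda>i. ?D i * \<rho>' * ?D i) {..<M}"
  have B: "B \<in> carrier_mat N N" by (simp add: B_def)
  have index_B: "B $$ (x, y) = (if x div ?d = y div ?d then \<rho>' $$ (x, y) else 0)" if "x < N" "y < N" for x y
  proof -
    have "B $$ (x, y) = (\<Sum>i<M. if i = x div ?d then if x div ?d = y div ?d then \<rho>' $$ (x, y) else 0 else 0)"
      unfolding B_def index_mat_sum[OF that] idx(2)[OF \<rho>' that] by (intro sum.cong refl) auto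
    then show ?thesis using div_less[OF N d that(1)] by simp
  qed
  have post: "post_measurement_state N M P \<rho> = evolve V B"
  proof -
    have "P i * \<rho> * P i = evolve V (?D i * \<rho>' * ?D i)" if "i < M" for i
      unfolding P[OF that] using V r D[of i]
      by (simp add: evolve_def \<rho>'_def assoc_mult_mat[of _ N N _ N _ N] mult_carrier_mat[of _ N N _ N])
    then have "post_measurement_state N M P \<rho> = mat_sum N (\<lambda>i. evolve V (?D i * \<rho>' * ?D i)) {..<M}"
      unfolding post_measurement_state_def by (intro mat_sum_cong) auto
    also have "\<dots> = evolve V B"
      unfolding B_def using V \<rho>' D
      by (intro evolve_mat_sum[symmetric]) (auto simp: mult_carrier_mat[of _ N N _ N])
    finally show ?thesis .
  qed
  have p: "complex_of_real (outcome_prob (P i) \<rho>) = (\<Sum>c<?d. \<rho>' $$ (i * ?d + c, i * ?d + c))" if i: "i < M" for i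
  proof -
    have "mat_trace (P i * \<rho>) = mat_trace (V * (?D i * mat_adjoint V * \<rho>))"
      unfolding P[OF i] using V r D[of i]
      by (simp add: evolve_def assoc_mult_mat[of _ N N _ N _ N] mult_carrier_mat[of _ N N _ N])
    also have "\<dots> = mat_trace (?D i * mat_adjoint V * \<rho> * V)"
      using V r D[of i] by (intro mat_trace_comm[of _ N N]) (auto simp: mult_carrier_mat[of _ N N _ N])
    also have "?D i * mat_adjoint V * \<rho> * V = ?D i * \<rho>'"
      using V r D[of i] by (simp add: \<rho>'_def assoc_mult_mat[of _ N N _ N _ N] mult_carrier_mat[of _ N N _ N])
    also have "mat_trace \<dots> = (\<Sum>x<N. \<Sum>y<N. if y = x then (if x div ?d = i then \<rho>' $$ (x, x) else 0) else 0)"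
      unfolding mat_trace_mult[OF D \<rho>'] by (intro sum.cong refl) (auto simp: idx)
    also have "\<dots> = (\<Sum>x<N. if x div ?d = i then \<rho>' $$ (x, x) else 0)" by simp
    also have "\<dots> = (\<Sum>j<M. if j = i then (\<Sum>c<?d. \<rho>' $$ (j * ?d + c, j * ?d + c)) else 0)"
      unfolding N sum_lessThan_times by (intro sum.cong refl) auto
    also have "\<dots> = (\<Sum>c<?d. \<rho>' $$ (i * ?d + c, i * ?d + c))" using i by simp
    finally have tr: "mat_trace (P i * \<rho>) = (\<Sum>c<?d. \<rho>' $$ (i * ?d + c, i * ?d + c))" .
    moreover have "Im (\<Sum>c<?d. \<rho>' $$ (i * ?d + c, i * ?d + c)) = 0"
      using i real_diag mult_add_less[of i M _ ?d] by (auto simp: N intro!: sum.neutral)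
    ultimately show ?thesis by (simp add: outcome_prob_def complex_eq_iff)
  qed
  define Q where "Q = mat_sum N (\<lambda>i. complex_of_real (outcome_prob (P i) \<rho> / real ?d) \<cdot>\<^sub>m ?D i) {..<M}"
  have index_Q: "Q $$ (x, y) = (if x = y then complex_of_real (outcome_prob (P (x div ?d)) \<rho> / real ?d) else 0)"
    if "x < N" "y < N" for x y
  proof -
    have "Q $$ (x, y) = (\<Sum>i<M. if i = x div ?d then if x = y then complex_of_real (outcome_prob (P (x div ?d)) \<rho> / real ?d) else 0 else 0)"
      unfolding Q_def index_mat_sum[OF that] using that carrier_matD[OF D]
      by (intro sum.cong refl) (auto simp: idx(1) simp del: kron_dim)
    then show ?thesis using div_less[OF N d that(1)] by simp
  qed
  have coarse: "coarse_state N M ?d P \<rho> = evolve V Q"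
  proof -
    have "c \<cdot>\<^sub>m P i = evolve V (c \<cdot>\<^sub>m ?D i)" if "i < M" for i c
      unfolding P[OF that] using V D[of i]
      by (simp add: evolve_def mult_smult_distrib[of _ N N _ N] mult_smult_assoc_mat[of _ N N _ N] mult_carrier_mat[of _ N N _ N])
    then have "coarse_state N M ?d P \<rho> = mat_sum N (\<lambda>i. evolve V (complex_of_real (outcome_prob (P i) \<rho> / real ?d) \<cdot>\<^sub>m ?D i)) {..<M}"
      unfolding coarse_state_def by (intro mat_sum_cong) auto
    also have "\<dots> = evolve V Q"
      unfolding Q_def using V D by (intro evolve_mat_sum[symmetric]) auto
    finally show ?thesis .
  qed
  let ?K = "\<lambda>U. kron (1\<^sub>m M) U :: complex mat"
  have K: "?K U \<in> carrier_mat N N" if "U \<in> pauli_group r" for U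
    using kron_carrier[OF one_carrier_mat[of M] pauli_group_carrier[OF that]] by (simp add: N)
  have twirl: "mat_sum N (\<lambda>U. evolve (?K U) B) (pauli_group r) = ?c \<cdot>\<^sub>m Q"
  proof (rule eq_matI)
    fix x y assume "x < dim_row (?c \<cdot>\<^sub>m Q)" "y < dim_col (?c \<cdot>\<^sub>m Q)"
    then have xy: "x < N" "y < N" by (auto simp: Q_def)
    note dm = div_less[OF N d xy(1)] div_less[OF N d xy(2)] mod_less[OF N d xy(1)] mod_less[OF N d xy(2)]
    let ?x = "x div ?d * ?d" and ?y = "y div ?d * ?d"
    have "mat_sum N (\<lambda>U. evolve (?K U) B) (pauli_group r) $$ (x, y) =
       (\<Sum>U\<in>pauli_group r. \<Sum>c<?d. \<Sum>e<?d. B $$ (?x + c, ?y + e) * (U $$ (x mod ?d, c) * cnj (U $$ (y mod ?d, e))))"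
      unfolding index_mat_sum[OF xy] evolve_def
      by (intro sum.cong refl index_kron_one_conjugate[OF N d _ B xy] pauli_group_carrier)
    also have "\<dots> = (\<Sum>c<?d. \<Sum>U\<in>pauli_group r. \<Sum>e<?d. B $$ (?x + c, ?y + e) * (U $$ (x mod ?d, c) * cnj (U $$ (y mod ?d, e))))"
      by (rule sum.swap)
    also have "\<dots> = (\<Sum>c<?d. \<Sum>e<?d. \<Sum>U\<in>pauli_group r. B $$ (?x + c, ?y + e) * (U $$ (x mod ?d, c) * cnj (U $$ (y mod ?d, e))))"
      by (intro sum.cong refl sum.swap)
    also have "\<dots> = (\<Sum>c<?d. \<Sum>e<?d. B $$ (?x + c, ?y + e) * (if x mod ?d = y mod ?d \<and> c = e then ?c / 2 ^ r else 0))"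
      unfolding sum_distrib_left[symmetric]
      using dm by (intro sum.cong refl arg_cong2[where f = "(*)"] pauli_group_completeness) auto
    also have "\<dots> = (\<Sum>c<?d. \<Sum>e<?d. if e = c then if x mod ?d = y mod ?d then B $$ (?x + c, ?y + c) * (?c / 2 ^ r) else 0 else 0)"
      by (intro sum.cong refl) auto
    also have "\<dots> = (\<Sum>c<?d. if x mod ?d = y mod ?d then B $$ (?x + c, ?y + c) * (?c / 2 ^ r) else 0)"
      by simp
    \<comment> \<open>Deletion of off-diagonal blocks is used here: entries of \<open>B\<close> with
      equal offsets vanish unless the blocks agree, and equal block together with equal remainder
      means \<open>x = y\<close>.\<close>
    also have "\<dots> = (\<Sum>c<?d. if x = y then \<rho>' $$ (?x + c, ?x + c) * (?c / 2 ^ r) else 0)"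
    proof (intro sum.cong refl)
      fix c assume "c \<in> {..<?d}"
      then have "?x + c < N" "?y + c < N" "(?x + c) div ?d = x div ?d" "(?y + c) div ?d = y div ?d"
        using dm mult_add_less by (auto simp: N)
      then show "(if x mod ?d = y mod ?d then B $$ (?x + c, ?y + c) * (?c / 2 ^ r) else 0) =
        (if x = y then \<rho>' $$ (?x + c, ?x + c) * (?c / 2 ^ r) else 0)"
        using eq_iff_div_mod[of x y ?d] by (auto simp: index_B simp del: div_mult_self3 div_mult_self4)
    qed
    also have "\<dots> = (if x = y then complex_of_real (outcome_prob (P (x div ?d)) \<rho>) * (?c / 2 ^ r) else 0)"
      unfolding p[OF dm(1)] by (cases "x = y") (simp_all only: sum_distrib_right simp_thms if_True if_False sum.neutral_const)
    also have "\<dots> = (?c \<cdot>\<^sub>m Q) $$ (x, y)"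
      using xy index_Q[OF xy] by (simp add: Q_def del: index_mat_sum)
    finally show "mat_sum N (\<lambda>U. evolve (?K U) B) (pauli_group r) $$ (x, y) = (?c \<cdot>\<^sub>m Q) $$ (x, y)" .
  qed (auto simp: Q_def)
  \<comment> \<open>The state carries \<open>V\<close> on its left, which cancels against the
    adjoint of \<open>V\<close> in the evolution, and likewise on the right.\<close>
  have "evolve (V * ?K U * mat_adjoint V) (post_measurement_state N M P \<rho>) = evolve V (evolve (?K U) B)"
    if "U \<in> pauli_group r" for U
    unfolding post using V B K[OF that]
    by (simp add: evolve_def mat_adjoint_mult[of _ N N _ N] assoc_mult_mat[of _ N N _ N _ N] mult_carrier_mat[of _ N N _ N] VV)
  then have "mat_sum N (\<lambda>U. evolve (V * ?K U * mat_adjoint V) (post_measurement_state N M P \<rho>)) (pauli_group r) =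
    mat_sum N (\<lambda>U. evolve V (evolve (?K U) B)) (pauli_group r)"
    by (rule mat_sum_cong)
  also have "\<dots> = evolve V (mat_sum N (\<lambda>U. evolve (?K U) B) (pauli_group r))"
    using V K B by (intro evolve_mat_sum[symmetric] evolve_carrier)
  also have "\<dots> = evolve V (?c \<cdot>\<^sub>m Q)" unfolding twirl ..
  also have "\<dots> = ?c \<cdot>\<^sub>m evolve V Q"
    using V by (simp add: Q_def evolve_def mult_smult_distrib[of _ N N _ N] mult_smult_assoc_mat[of _ N N _ N] mult_carrier_mat[of _ N N _ N])
  finally show ?thesis unfolding coarse .
qed

subsection \<open>One iteration of the protocol\<close>

context
  fixes K :: nat and h :: "nat \<Rightarrow> real"
  assumes K: "K \<ge> 1" and h: "\<And>j. j < K \<Longrightarrow> h j > 0"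
begin

lemma weights_pos: "(\<Sum>j<K. h j) > 0"
  using K h by (intro sum_pos) (auto simp: lessThan_empty_iff)

lemma pmf_sample_term: "pmf (sample_term K h) j = (if j < K then h j / (\<Sum>i<K. h i) else 0)"
  unfolding sample_term_def
proof (rule pmf_embed_pmf)
  show "0 \<le> (if j < K then h j / (\<Sum>i<K. h i) else 0)" for j
    using h[of j] weights_pos by auto
  have "(\<integral>\<^sup>+ j. ennreal (if j < K then h j / (\<Sum>i<K. h i) else 0) \<partial>count_space UNIV) =
     (\<Sum>j<K. ennreal (h j / (\<Sum>i<K. h i)))"
    by (subst nn_integral_count_space'[of "{..<K}"]) auto
  also have "\<dots> = ennreal (\<Sum>j<K. h j / (\<Sum>i<K. h i))"
    using h weights_pos by (intro sum_ennreal) (auto intro: divide_nonneg_pos less_imp_le)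
  also have "(\<Sum>j<K. h j / (\<Sum>i<K. h i)) = 1"
    using weights_pos by (simp flip: sum_divide_distrib)
  finally show "(\<integral>\<^sup>+ j. ennreal (if j < K then h j / (\<Sum>i<K. h i) else 0) \<partial>count_space UNIV) = 1"
    by simp
qed

lemma set_sample_term: "set_pmf (sample_term K h) \<subseteq> {..<K}"
  by (auto simp: set_pmf_iff pmf_sample_term split: if_splits)

context
  fixes n :: nat and \<Lambda> :: "nat \<Rightarrow> complex mat" and \<sigma> :: "complex mat"
  assumes \<Lambda>: "\<And>j. j < K \<Longrightarrow> signed_pauli_string n (\<Lambda> j)" and \<sigma>: "density_matrix (2 ^ n) \<sigma>"
begin

lemma set_measure_sample:
  "set_pmf (bind_pmf (sample_term K h) (\<lambda>j. measure_observable (\<Lambda> j) \<sigma>)) \<subseteq> {- 1, 1}"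
  using hermitian_involution.set_measure_observable[OF hermitian_involution_signed_pauli_string[OF \<Lambda>] \<sigma>]
    set_sample_term by fastforce

text \<open>Conditioning on the sampled term: its weight times the mean of its measurement. By
  \<open>trace_hamiltonian\<close> the numerator is Tr[H \<sigma>] when \<Lambda> are the terms of
  H.\<close>

lemma expectation_measure_sample:
  "measure_pmf.expectation (bind_pmf (sample_term K h) (\<lambda>j. measure_observable (\<Lambda> j) \<sigma>)) (\<lambda>x. x) =
    (\<Sum>j<K. h j * Re (mat_trace (\<sigma> * \<Lambda> j))) / (\<Sum>j<K. h j)"
proof -
  note hi = hermitian_involution_signed_pauli_string[OF \<Lambda>]
  have "measure_pmf.expectation (bind_pmf (sample_term K h) (\<lambda>j. measure_observable (\<Lambda> j) \<sigma>)) (\<lambda>x. x) =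
    (\<Sum>j<K. pmf (sample_term K h) j *\<^sub>R measure_pmf.expectation (measure_observable (\<Lambda> j) \<sigma>) (\<lambda>x. x))"
    using set_sample_term hermitian_involution.set_measure_observable[OF hi \<sigma>]
    by (intro pmf_expectation_bind) (auto intro: finite_subset)
  also have "\<dots> = (\<Sum>j<K. h j * Re (mat_trace (\<sigma> * \<Lambda> j)) / (\<Sum>j<K. h j))"
    using hermitian_involution.expectation_measure_observable[OF hi \<sigma>]
    by (intro sum.cong refl) (simp add: pmf_sample_term)
  finally show ?thesis by (simp add: sum_divide_distrib)
qed

end

end

lemma trace_hamiltonian:
  assumes "\<And>j. j < K \<Longrightarrow> \<Lambda> j \<in> carrier_mat N N" "\<sigma> \<in> carrier_mat N N"
  shows "Re (mat_trace (mat_sum N (\<lambda>j. complex_of_real (h j) \<cdot>\<^sub>m \<Lambda> j) {..<K} * \<sigma>)) =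
    (\<Sum>j<K. h j * Re (mat_trace (\<sigma> * \<Lambda> j)))"
proof -
  have "mat_sum N (\<lambda>j. complex_of_real (h j) \<cdot>\<^sub>m \<Lambda> j) {..<K} * \<sigma> =
    mat_sum N (\<lambda>j. complex_of_real (h j) \<cdot>\<^sub>m (\<Lambda> j * \<sigma>)) {..<K}"
    using assms by (subst mat_sum_mult) (auto intro!: mat_sum_cong mult_smult_assoc_mat)
  then have "mat_trace (mat_sum N (\<lambda>j. complex_of_real (h j) \<cdot>\<^sub>m \<Lambda> j) {..<K} * \<sigma>) =
    (\<Sum>j<K. mat_trace (complex_of_real (h j) \<cdot>\<^sub>m (\<Lambda> j * \<sigma>)))"
    using assms by (auto simp: mult_carrier_mat[of _ N N _ N] intro!: mat_trace_mat_sum)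
  also have "\<dots> = (\<Sum>j<K. h j * mat_trace (\<sigma> * \<Lambda> j))"
  proof (intro sum.cong refl)
    fix j assume "j \<in> {..<K}"
    then have c: "\<Lambda> j \<in> carrier_mat N N" using assms by auto
    show "mat_trace (complex_of_real (h j) \<cdot>\<^sub>m (\<Lambda> j * \<sigma>)) = h j * mat_trace (\<sigma> * \<Lambda> j)"
      using mat_trace_smult[of "\<Lambda> j * \<sigma>" N] mat_trace_comm[OF c assms(2)] mult_carrier_mat[OF c assms(2)] by simp
  qed
  finally show ?thesis by simp
qed

lemma signed_pauli_string_carrier:
  "signed_pauli_string n A \<Longrightarrow> A \<in> carrier_mat (2 ^ n) (2 ^ n)"
  by (rule hermitian_involution.carrier[OF hermitian_involution_signed_pauli_string])

text \<open>The first branch has mean Tr[H \<rho>]/h; the second has minus the twirled energy over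
  h. The range supplies the boundedness for the concentration bound, the mean its centre.\<close>

lemma protocol_iteration_range_and_mean:
  assumes N: "N = 2 ^ n" and M: "M = 2 ^ (n - r)" and rn: "r \<le> n"
    and K: "K \<ge> 1" and h: "\<And>j. j < K \<Longrightarrow> h j > 0"
    and \<Lambda>: "\<And>j. j < K \<Longrightarrow> signed_pauli_string n (\<Lambda> j)"
    and H: "H = mat_sum N (\<lambda>j. complex_of_real (h j) \<cdot>\<^sub>m \<Lambda> j) {..<K}"
    and cg: "coarse_graining N M (2 ^ r) P" and bi: "block_identification N M (2 ^ r) P V"
    and \<rho>: "density_matrix N \<rho>" and gl: "global_unitary N M (2 ^ r) H P \<rho> Ugl"
  shows "set_pmf (protocol_iteration n r K h \<Lambda> P V Ugl \<rho>) \<subseteq> {- 1, 1}" (is "set_pmf ?it \<subseteq> _")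
    and "2 * (\<Sum>j<K. h j) * measure_pmf.expectation (protocol_iteration n r K h \<Lambda> P V Ugl \<rho>) (\<lambda>x. x) =
      obs_ergotropy N M (2 ^ r) H P \<rho>"
proof -
  let ?G = "pauli_group r"
  let ?s = "\<Sum>j<K. h j"
  define X where "X U = V * kron (1\<^sub>m M) U * mat_adjoint V" for U
  define \<tau> where "\<tau> U = evolve (Ugl * X U) (post_measurement_state N M P \<rho>)" for U
  define gain where "gain = bind_pmf (sample_term K h) (\<lambda>j. measure_observable (\<Lambda> j) \<rho>)"
  define cost where "cost U = bind_pmf (sample_term K h) (\<lambda>j. measure_observable (- \<Lambda> j) (\<tau> U))" for U
  have N': "N = M * 2 ^ r" using N M rn by (simp flip: power_add)
  have it: "?it = bind_pmf (bernoulli_pmf (1/2)) (\<lambda>b. if b then gain else bind_pmf (pmf_of_set ?G) cost)"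
    unfolding protocol_iteration_def gain_def cost_def[abs_def] \<tau>_def X_def N M ..
  have s: "?s > 0" using K h by (rule weights_pos)
  have G: "?G \<noteq> {}" "card ?G > 0" using card_pauli_group[of r] by auto
  have V: "unitary_mat N V" and Ugl: "unitary_mat N Ugl" and P: "density_matrix N (post_measurement_state N M P \<rho>)"
    using bi gl density_matrix_post_measurement[OF \<rho> cg]
    by (auto simp: block_identification_def global_unitary_def)
  have uX: "unitary_mat N (X U)" if "U \<in> ?G" for U
    unfolding X_def using unitary_mat_kron_one[OF unitary_pauli_group[OF that], of M] N' V
    by (intro unitary_mat_mult unitary_mat_adjoint) auto
  have \<tau>: "density_matrix (2 ^ n) (\<tau> U)" if "U \<in> ?G" for U
    unfolding \<tau>_def N[symmetric] by (intro density_matrix_evolve unitary_mat_mult P Ugl uX that)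
  have \<rho>n: "density_matrix (2 ^ n) \<rho>" using \<rho> N by simp
  have m\<Lambda>: "signed_pauli_string n (- \<Lambda> j)" if "j < K" for j
    using \<Lambda>[OF that] by (rule signed_pauli_string_uminus)
  have \<Lambda>c: "\<Lambda> j \<in> carrier_mat N N" if "j < K" for j
    using signed_pauli_string_carrier[OF \<Lambda>[OF that]] N by simp
  have set_gain: "set_pmf gain \<subseteq> {- 1, 1}"
    unfolding gain_def by (rule set_measure_sample[OF K h \<Lambda> \<rho>n])
  have set_cost: "set_pmf (cost U) \<subseteq> {- 1, 1}" if "U \<in> ?G" for U
    unfolding cost_def by (rule set_measure_sample[OF K h m\<Lambda> \<tau>[OF that]])
  have set_costs: "set_pmf (bind_pmf (pmf_of_set ?G) cost) \<subseteq> {- 1, 1}"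
    using set_cost G by (auto simp: set_pmf_of_set)
  show "set_pmf ?it \<subseteq> {- 1, 1}"
    unfolding it set_bind_pmf[of "bernoulli_pmf (1/2)"] using set_gain set_costs
    by (intro UN_least) (simp del: set_bind_pmf split: if_split)

  have \<rho>c: "\<rho> \<in> carrier_mat N N" using \<rho> by (auto simp: density_matrix_def)
  have \<tau>c: "\<tau> U \<in> carrier_mat N N" if "U \<in> ?G" for U
    using \<tau>[OF that] N by (auto simp: density_matrix_def)
  have e_gain: "measure_pmf.expectation gain (\<lambda>x. x) = Re (mat_trace (H * \<rho>)) / ?s"
  proof -
    have "measure_pmf.expectation gain (\<lambda>x. x) = (\<Sum>j<K. h j * Re (mat_trace (\<rho> * \<Lambda> j))) / ?s"
      unfolding gain_def by (rule expectation_measure_sample[OF K h \<Lambda> \<rho>n])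
    then show ?thesis unfolding H by (subst trace_hamiltonian[OF \<Lambda>c \<rho>c]) auto
  qed
  have e_cost: "measure_pmf.expectation (cost U) (\<lambda>x. x) = - (Re (mat_trace (H * \<tau> U)) / ?s)"
    if U: "U \<in> ?G" for U
  proof -
    have neg: "mat_trace (\<tau> U * - \<Lambda> j) = - mat_trace (\<tau> U * \<Lambda> j)" if "j < K" for j
      using mat_trace_mult[OF \<tau>c[OF U] \<Lambda>c[OF that]] mat_trace_mult[OF \<tau>c[OF U], of "- \<Lambda> j"]
        carrier_matD[OF \<Lambda>c[OF that]] \<Lambda>c[OF that] by (simp add: sum_negf)
    have "measure_pmf.expectation (cost U) (\<lambda>x. x) = (\<Sum>j<K. h j * Re (mat_trace (\<tau> U * - \<Lambda> j))) / ?s"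
      unfolding cost_def by (rule expectation_measure_sample[OF K h m\<Lambda> \<tau>[OF U]])
    then show ?thesis
      unfolding H by (subst trace_hamiltonian[OF \<Lambda>c \<tau>c[OF U]]) (auto simp: neg sum_negf)
  qed
  have Hc: "H \<in> carrier_mat N N" unfolding H by simp
  have Uc: "Ugl \<in> carrier_mat N N" using Ugl by (auto simp: unitary_mat_def)
  \<comment> \<open>Evolution is linear in the state, so the global unitary can be pulled out of the
    sum over the Pauli group before the twirl is applied.\<close>
  have \<tau>_sum: "mat_sum N \<tau> ?G = of_nat (card ?G) \<cdot>\<^sub>m evolve Ugl (coarse_state N M (2 ^ r) P \<rho>)"
  proof -
    have c: "evolve (X U) (post_measurement_state N M P \<rho>) \<in> carrier_mat N N" if "U \<in> ?G" for U
      using uX[OF that] P by (intro evolve_carrier) (auto simp: unitary_mat_def density_matrix_def)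
    have "mat_sum N \<tau> ?G = mat_sum N (\<lambda>U. evolve Ugl (evolve (X U) (post_measurement_state N M P \<rho>))) ?G"
      unfolding \<tau>_def using uX P Uc
      by (intro mat_sum_cong evolve_mult[of _ N]) (auto simp: unitary_mat_def density_matrix_def)
    also have "\<dots> = evolve Ugl (mat_sum N (\<lambda>U. evolve (X U) (post_measurement_state N M P \<rho>)) ?G)"
      using Uc c by (intro evolve_mat_sum[symmetric])
    also have "\<dots> = evolve Ugl (of_nat (card ?G) \<cdot>\<^sub>m coarse_state N M (2 ^ r) P \<rho>)"
      unfolding X_def pauli_twirl[OF N' cg bi \<rho>] ..
    finally show ?thesis
      using Uc by (simp add: evolve_def coarse_state_def mult_smult_distrib[of _ N N _ N]
          mult_smult_assoc_mat[of _ N N _ N] mult_carrier_mat[of _ N N _ N])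
  qed
  let ?R = "coarse_state N M (2 ^ r) P \<rho>"
  have "(\<Sum>U\<in>?G. Re (mat_trace (H * \<tau> U))) = Re (mat_trace (H * mat_sum N \<tau> ?G))"
    using Hc \<tau>c by (simp add: mult_mat_sum mat_trace_mat_sum mult_carrier_mat[of _ N N _ N])
  also have "\<dots> = card ?G * Re (mat_trace (H * Ugl * ?R * mat_adjoint Ugl))"
  proof -
    have R: "?R \<in> carrier_mat N N" by (simp add: coarse_state_def)
    have "H * mat_sum N \<tau> ?G = of_nat (card ?G) \<cdot>\<^sub>m (H * Ugl * ?R * mat_adjoint Ugl)"
      unfolding \<tau>_sum evolve_def using Hc Uc R
      by (simp add: mult_smult_distrib[of _ N N _ N] assoc_mult_mat[of _ N N _ N _ N] mult_carrier_mat[of _ N N _ N])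
    then show ?thesis
      using Hc Uc R by (simp add: mat_trace_smult[of _ N] mult_carrier_mat[of _ N N _ N])
  qed
  finally have avg: "(\<Sum>U\<in>?G. Re (mat_trace (H * \<tau> U))) / card ?G = Re (mat_trace (H * Ugl * ?R * mat_adjoint Ugl))"
    using G by simp

  have "measure_pmf.expectation (bind_pmf (pmf_of_set ?G) cost) (\<lambda>x. x) =
      (\<Sum>U\<in>?G. measure_pmf.expectation (cost U) (\<lambda>x. x) /\<^sub>R real (card ?G))"
    using G by (intro pmf_expectation_bind_pmf_of_set) (auto intro: finite_subset[OF set_cost])
  also have "\<dots> = - ((\<Sum>U\<in>?G. Re (mat_trace (H * \<tau> U))) / card ?G) / ?s"
    by (simp add: e_cost sum_negf sum_divide_distrib divide_inverse mult_ac sum_distrib_left)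
  finally have e_costs: "measure_pmf.expectation (bind_pmf (pmf_of_set ?G) cost) (\<lambda>x. x) =
    - Re (mat_trace (H * Ugl * ?R * mat_adjoint Ugl)) / ?s" unfolding avg .

  \<comment> \<open>The fair coin averages the two branch means, producing the 2 in the denominator
    that the output's prefactor removes.\<close>
  have "measure_pmf.expectation ?it (\<lambda>x. x) =
    (\<Sum>b\<in>UNIV. pmf (bernoulli_pmf (1/2)) b *\<^sub>R
      measure_pmf.expectation (if b then gain else bind_pmf (pmf_of_set ?G) cost) (\<lambda>x. x))"
    unfolding it using set_gain set_costs
    by (intro pmf_expectation_bind) (auto intro: finite_subset split: if_splits)
  also have "\<dots> = (Re (mat_trace (H * \<rho>)) - Re (mat_trace (H * Ugl * ?R * mat_adjoint Ugl))) / (2 * ?s)"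
    by (simp add: UNIV_bool e_gain e_costs diff_divide_distrib)
  finally show "2 * ?s * measure_pmf.expectation ?it (\<lambda>x. x) = obs_ergotropy N M (2 ^ r) H P \<rho>"
    unfolding obs_ergotropy_global_unitary[OF cg N' Hc gl] using s by simp
qed

subsection \<open>Concentration of the output\<close>

text \<open>Each variable ranges over an interval of length 2, so the squared lengths add up to 4
  |I| and the exponent 2 \<epsilon>^2 / (4 |I|) simplifies to the stated one. The default value 0 of
  \<open>Pi_pmf\<close> concerns coordinates outside \<open>I\<close>, which the sum never
  reads.\<close>

lemma Hoeffding_Pi_pmf:
  fixes p :: "real pmf"
  assumes p: "set_pmf p \<subseteq> {- 1..1}" and I: "finite I" "I \<noteq> {}" and "\<epsilon> \<ge> 0"
  shows "measure_pmf.prob (Pi_pmf I 0 (\<lambda>_. p))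
      {x. \<bar>(\<Sum>i\<in>I. x i) - real (card I) * measure_pmf.expectation p (\<lambda>x. x)\<bar> \<ge> \<epsilon>}
    \<le> 2 * exp (- \<epsilon>\<^sup>2 / (2 * real (card I)))"
proof -
  let ?Q = "Pi_pmf I 0 (\<lambda>_. p)"
  have comp: "map_pmf (\<lambda>x. x i) ?Q = p" if "i \<in> I" for i
    using that I by (simp add: Pi_pmf_component)
  interpret Hoeffding_ineq ?Q I "\<lambda>i x. x i" "\<lambda>_. - 1" "\<lambda>_. 1" "real (card I) * measure_pmf.expectation p (\<lambda>x. x)"
  proof unfold_locales
    show "prob_space.indep_vars (measure_pmf ?Q) (\<lambda>_. borel) (\<lambda>i x. x i) I"
      by (intro prob_space.indep_vars_compose2[OF _ indep_vars_Pi_pmf] I)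
         (auto simp: measure_pmf.prob_space_axioms)
    show "AE x in ?Q. x i \<in> {- 1..1}" if "i \<in> I" for i
    proof -
      have "(\<lambda>x. x i) ` set_pmf ?Q = set_pmf p" using comp[OF that] by (metis set_map_pmf)
      then have "x i \<in> {- 1..1}" if "x \<in> set_pmf ?Q" for x using p that by blast
      then show ?thesis by (simp add: AE_measure_pmf_iff)
    qed
    have "measure_pmf.expectation ?Q (\<lambda>x. x i) = measure_pmf.expectation p (\<lambda>x. x)" if "i \<in> I" for i
      using integral_map_pmf[of "\<lambda>x. x i" ?Q "\<lambda>x. x"] comp[OF that] by simp
    then show "real (card I) * measure_pmf.expectation p (\<lambda>x. x) \<equiv> \<Sum>i\<in>I. measure_pmf.expectation ?Q (\<lambda>x. x i)"
      by simp
  qed (use I in auto)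
  have "0 < card I" using I by (simp add: card_gt_0_iff)
  then show ?thesis using Hoeffding_ineq_abs_ge[OF \<open>\<epsilon> \<ge> 0\<close>] by simp
qed

theorem mainTheorem4:
  shows "\<exists>C :: real. C > 0 \<and>
    (\<forall>(n :: nat) (r :: nat) (N :: nat) (M :: nat) (K :: nat) (h :: nat \<Rightarrow> real)
       (\<Lambda> :: nat \<Rightarrow> complex mat) (H :: complex mat) (P :: nat \<Rightarrow> complex mat)
       (V :: complex mat) (\<rho> :: complex mat) (Ugl :: complex mat)
       (\<epsilon> :: real) (\<delta> :: real) (T :: nat).
       r \<le> n \<longrightarrow> N = 2 ^ n \<longrightarrow> M = 2 ^ (n - r) \<longrightarrow>
       K \<ge> 1 \<longrightarrow> (\<forall>j<K. h j > 0) \<longrightarrow> (\<forall>j<K. signed_pauli_string n (\<Lambda> j)) \<longrightarrow>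
       H = mat_sum N (\<lambda>j. complex_of_real (h j) \<cdot>\<^sub>m \<Lambda> j) {..<K} \<longrightarrow>
       coarse_graining N M (2 ^ r) P \<longrightarrow>
       block_identification N M (2 ^ r) P V \<longrightarrow>
       density_matrix N \<rho> \<longrightarrow>
       global_unitary N M (2 ^ r) H P \<rho> Ugl \<longrightarrow>
       \<epsilon> > 0 \<longrightarrow> 0 < \<delta> \<longrightarrow> \<delta> < 1 \<longrightarrow>
       T \<ge> 1 \<longrightarrow> real T \<ge> C * ((\<Sum>j<K. h j)\<^sup>2 * ln (2 / \<delta>) / \<epsilon>\<^sup>2) \<longrightarrow>
       measure_pmf.prob (protocol_output n r K h \<Lambda> P V Ugl \<rho> T)
         {\<mu>. \<bar>\<mu> - obs_ergotropy N M (2 ^ r) H P \<rho>\<bar> \<le> \<epsilon>} \<ge> 1 - \<delta>)"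
proof (rule exI[of _ 8], intro conjI allI impI)
  fix n r N M K :: nat and h \<Lambda> H P V \<rho> Ugl and \<epsilon> \<delta> :: real and T :: nat
  assume hyps: "r \<le> n" "N = 2 ^ n" "M = 2 ^ (n - r)" "K \<ge> 1" "\<forall>j<K. h j > 0"
    "\<forall>j<K. signed_pauli_string n (\<Lambda> j)"
    "H = mat_sum N (\<lambda>j. complex_of_real (h j) \<cdot>\<^sub>m \<Lambda> j) {..<K}"
    "coarse_graining N M (2 ^ r) P" "block_identification N M (2 ^ r) P V"
    "density_matrix N \<rho>" "global_unitary N M (2 ^ r) H P \<rho> Ugl"
    and \<epsilon>: "\<epsilon> > 0" and \<delta>: "0 < \<delta>" "\<delta> < 1" and T: "T \<ge> 1"
    and T_ge: "real T \<ge> 8 * ((\<Sum>j<K. h j)\<^sup>2 * ln (2 / \<delta>) / \<epsilon>\<^sup>2)"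
  define p where "p = protocol_iteration n r K h \<Lambda> P V Ugl \<rho>"
  define m where "m = measure_pmf.expectation p (\<lambda>x. x)"
  define s where "s = (\<Sum>j<K. h j)"
  define Q where "Q = Pi_pmf {1..T} 0 (\<lambda>_. p)"
  define g where "g \<mu> = 2 * s / real T * (\<Sum>j\<in>{1..T}. \<mu> j)" for \<mu> :: "nat \<Rightarrow> real"
  \<comment> \<open>The deviation of the unscaled sum that corresponds to a deviation \<epsilon> of
    the output.\<close>
  define t where "t = \<epsilon> * T / (2 * s)"
  let ?erg = "obs_ergotropy N M (2 ^ r) H P \<rho>"
  have s: "s > 0" unfolding s_def using hyps by (intro weights_pos) auto
  note it = protocol_iteration_range_and_mean[OF hyps(2,3,1,4) _ _ hyps(7-11)]
  have range: "set_pmf p \<subseteq> {- 1, 1}" unfolding p_def using hyps by (intro it(1)) auto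
  have erg: "2 * s * m = ?erg" unfolding m_def p_def s_def using hyps by (intro it(2)) auto
  have out: "protocol_output n r K h \<Lambda> P V Ugl \<rho> T = map_pmf g Q"
    unfolding protocol_output_def Q_def p_def g_def s_def ..
  have "8 * s\<^sup>2 * ln (2 / \<delta>) \<le> T * \<epsilon>\<^sup>2"
    using T_ge \<epsilon> by (simp add: s_def field_simps)
  \<comment> \<open>Here t^2 / (2 T) = T \<epsilon>^2 / (8 s^2), which is where the constant 8
    arises.\<close>
  then have "ln (2 / \<delta>) \<le> t\<^sup>2 / (2 * T)"
    using s T by (simp add: t_def field_simps power2_eq_square)
  then have "2 * exp (- (t\<^sup>2 / (2 * T))) \<le> 2 * exp (- ln (2 / \<delta>))" by simp
  also have "\<dots> = \<delta>" using \<delta> by (simp add: exp_minus)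
  finally have exp_le: "2 * exp (- (t\<^sup>2 / (2 * T))) \<le> \<delta>" .
  \<comment> \<open>The failure event is a strict inequality for the output; it lies in the
    non-strict deviation event that Hoeffding's inequality bounds.\<close>
  have "measure_pmf.prob Q (- {x. \<bar>g x - ?erg\<bar> \<le> \<epsilon>}) \<le> measure_pmf.prob Q {x. \<bar>(\<Sum>i\<in>{1..T}. x i) - T * m\<bar> \<ge> t}"
  proof (rule measure_pmf.finite_measure_mono)
    have "\<bar>(\<Sum>i\<in>{1..T}. x i) - T * m\<bar> \<ge> t" if "\<bar>g x - ?erg\<bar> > \<epsilon>" for x
    proof -
      have "g x - ?erg = 2 * s / T * ((\<Sum>i\<in>{1..T}. x i) - T * m)"
        using T by (simp add: g_def erg[symmetric] field_simps)
      then have "\<bar>g x - ?erg\<bar> = 2 * s / T * \<bar>(\<Sum>i\<in>{1..T}. x i) - T * m\<bar>"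
        using s by (simp add: abs_mult)
      with that show ?thesis using s T by (simp add: t_def field_simps)
    qed
    then show "- {x. \<bar>g x - ?erg\<bar> \<le> \<epsilon>} \<subseteq> {x. \<bar>(\<Sum>i\<in>{1..T}. x i) - T * m\<bar> \<ge> t}" by auto
  qed simp
  also have "\<dots> \<le> 2 * exp (- (t\<^sup>2 / (2 * T)))"
  proof -
    have "t \<ge> 0" "set_pmf p \<subseteq> {- 1..1}" using \<epsilon> s range by (auto simp: t_def)
    then show ?thesis
      using Hoeffding_Pi_pmf[of p "{1..T}" t] T unfolding Q_def m_def by simp
  qed
  also note exp_le
  also have "measure_pmf.prob Q (- {x. \<bar>g x - ?erg\<bar> \<le> \<epsilon>}) = 1 - measure_pmf.prob Q {x. \<bar>g x - ?erg\<bar> \<le> \<epsilon>}"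
    using measure_pmf.prob_compl[of "{x. \<bar>g x - ?erg\<bar> \<le> \<epsilon>}" Q] by (simp add: Compl_eq_Diff_UNIV)
  finally show "measure_pmf.prob (protocol_output n r K h \<Lambda> P V Ugl \<rho> T) {\<mu>. \<bar>\<mu> - ?erg\<bar> \<le> \<epsilon>} \<ge> 1 - \<delta>"
    unfolding out by (simp add: vimage_def)
qed simp

end
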